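(* For any $r\in\mathbb{N}$ and $\delta\in(0,1]$, and for all $\varepsilon\in(0,1)$, $$n(\varepsilon,F_{d,r,\delta})\ \ge\ (1-\varepsilon)\cdot\begin{cases}1 & \text{for } d=1,\\ \left(\delta\sqrt{18e\pi}\right)^{-d} & \text{for } d\ge 2.\end{cases}$$ Hence the curse of dimensionality holds for the class $F_{d,r,\delta}$ for $\delta<1/\sqrt{18e\pi}$.
   Context: $\mathbb{N}=\{1,2,\dots\}$; $e$ is Euler's number. For each $d\in\mathbb{N}$ let $D_d\subset\mathbb{R}^d$ be an arbitrary fixed (measurable) set of Lebesgue measure $1$ (for example $[0,1]^d$), and let $S_d(f)=\int_{D_d}f(x)\,dx$. Notation: $\mathbb{S}^{d-1}$ is the Euclidean unit sphere in $\mathbb{R}^d$; $\|f\|=\sup_{x\in\mathbb{R}^d}|f(x)|$; $\mathrm{Lip}(f)=\sup_{x\ne y}\frac{|f(x)-f(y)|}{\|x-y\|_2}$. For $\theta\in\mathbb{S}^{d-1}$, $D^{\theta}f(x)=\lim_{h\to0}\frac1h\bigl(f(x+h\theta)-f(x)\bigr)$ is the directional derivative. $C^r$ is the set of $f:\mathbb{R}^d\to\mathbb{R}$ such that $D^{\theta_\ell}\cdots D^{\theta_1}f$ is continuous for all $\ell\le r$ and all $\theta_1,\dots,\theta_r\in\mathbb{S}^{d-1}$ (the case $\ell=0$ being $f$ itself). The class: $F_{d,r,\delta}$ is the set of all $f:\mathbb{R}^d\to\mathbb{R}$ with $f\in C^r$ such that (1) $\|f\|\le 1$; (2) $\mathrm{Lip}(f)\le\frac{1}{\delta\sqrt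 d}$; (3) for all $k\in\{1,\dots,r\}$ and all $\theta_1,\dots,\theta_k\in\mathbb{S}^{d-1}$, $\ \mathrm{Lip}(D^{\theta_1}\cdots D^{\theta_k}f)\le\frac{1}{\delta\sqrt d}\left(\frac{r}{\delta}\right)^k$. Complexity: For a class $F_d$ of continuous functions $f:\mathbb{R}^d\to\mathbb{R}$ for which $S_d(f)$ exists, an algorithm using $n$ function values is a map $A_{n,d}(f)=\phi_{n,d}(f(x_1),\dots,f(x_n))$, where $\phi_{n,d}:\mathbb{R}^n\to\mathbb{R}$ is arbitrary and the points $x_j\in\mathbb{R}^d$ may be chosen adaptively, i.e. $x_j$ may depend on $f(x_1),\dots,f(x_{j-1})$. Its worst case error is $e(A_{n,d})=\sup_{f\in F_d}|S_d(f)-A_{n,d}(f)|$. Define $n(\varepsilon,F_d)=\min\{n\in\mathbb{N} : \exists\,A_{n,d}\text{ with } e(A_{n,d})\le\varepsilon\}$ (with value $\infty$ if there is no such $n$). The curse of dimensionality holds for the classes $F_d$ if there are positive numbers $c,\varepsilon_0,\gamma$ such that $n(\varepsilon,F_d)\ge c(1+\gamma)^d$ for all $\varepsilon\in(0,\varepsilon_0]$ and infinitely many $d\in\mathbb{N}$. *)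

theory Defs
  imports "HOL-Analysis.Analysis"
begin

text \<open>
  The dimension \<open>d\<close> varies inside the statement, so vectors of \<open>\<real>\<^sup>d\<close> are the functions of type
  \<open>nat \<Rightarrow> real\<close> that are extensional on \<open>{..<d}\<close>. This set is both the space of the measure
  \<open>Pi\<^sub>M {..<d} (\<lambda>_. lborel)\<close> and the underlying set of the topology \<open>powertop_real {..<d}\<close>.
  A function on \<open>\<real>\<^sup>d\<close> has type \<open>(nat \<Rightarrow> real) \<Rightarrow> real\<close>; its values outside \<open>Rd d\<close> are
  irrelevant to every notion below.
\<close>

definition Rd :: "nat \<Rightarrow> (nat \<Rightarrow> real) set" where
  "Rd d = {..<d} \<rightarrow>\<^sub>E UNIV"

definition vnorm :: "nat \<Rightarrow> (nat \<Rightarrow> real) \<Rightarrow> real" where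
  "vnorm d x = L2_set x {..<d}"

definition vdist :: "nat \<Rightarrow> (nat \<Rightarrow> real) \<Rightarrow> (nat \<Rightarrow> real) \<Rightarrow> real" where
  "vdist d x y = L2_set (\<lambda>i. x i - y i) {..<d}"

definition unit_sphere :: "nat \<Rightarrow> (nat \<Rightarrow> real) set" where
  "unit_sphere d = {\<theta> \<in> Rd d. vnorm d \<theta> = 1}"

text \<open>The point \<open>x + h \<theta>\<close>.\<close>

definition shift :: "nat \<Rightarrow> (nat \<Rightarrow> real) \<Rightarrow> real \<Rightarrow> (nat \<Rightarrow> real) \<Rightarrow> nat \<Rightarrow> real" where
  "shift d x h \<theta> = (\<lambda>i\<in>{..<d}. x i + h * \<theta> i)"

text \<open>The completion makes this Lebesgue measure on the Lebesgue (not only the Borel) sets.\<close>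

definition leb :: "nat \<Rightarrow> (nat \<Rightarrow> real) measure" where
  "leb d = completion (Pi\<^sub>M {..<d} (\<lambda>_. lborel))"

definition sup_norm :: "nat \<Rightarrow> ((nat \<Rightarrow> real) \<Rightarrow> real) \<Rightarrow> ereal" where
  "sup_norm d f = (SUP x\<in>Rd d. ereal \<bar>f x\<bar>)"

definition Lip :: "nat \<Rightarrow> ((nat \<Rightarrow> real) \<Rightarrow> real) \<Rightarrow> ereal" where
  "Lip d f = (SUP (x, y)\<in>{(x, y). x \<in> Rd d \<and> y \<in> Rd d \<and> x \<noteq> y}.
                ereal (\<bar>f x - f y\<bar> / vdist d x y))"

definition diff_quot ::
    "nat \<Rightarrow> (nat \<Rightarrow> real) \<Rightarrow> ((nat \<Rightarrow> real) \<Rightarrow> real) \<Rightarrow> (nat \<Rightarrow> real) \<Rightarrow> real \<Rightarrow> real" where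
  "diff_quot d \<theta> f x h = (1 / h) * (f (shift d x h \<theta>) - f x)"

definition dir_diff :: "nat \<Rightarrow> (nat \<Rightarrow> real) \<Rightarrow> ((nat \<Rightarrow> real) \<Rightarrow> real) \<Rightarrow> bool" where
  "dir_diff d \<theta> f \<longleftrightarrow> (\<forall>x\<in>Rd d. \<exists>L. (diff_quot d \<theta> f x \<longlongrightarrow> L) (at 0))"

definition dir_deriv ::
    "nat \<Rightarrow> (nat \<Rightarrow> real) \<Rightarrow> ((nat \<Rightarrow> real) \<Rightarrow> real) \<Rightarrow> (nat \<Rightarrow> real) \<Rightarrow> real" where
  "dir_deriv d \<theta> f x = Lim (at 0) (diff_quot d \<theta> f x)"

text \<open>
  The list \<open>[\<theta>\<^sub>1, \<dots>, \<theta>\<^sub>k]\<close> stands for \<open>D\<^bsup>\<theta>\<^sub>1\<^esup> \<cdots> D\<^bsup>\<theta>\<^sub>k\<^esup> f\<close>: its last entry is applied first.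
\<close>

fun iter_deriv ::
    "nat \<Rightarrow> (nat \<Rightarrow> real) list \<Rightarrow> ((nat \<Rightarrow> real) \<Rightarrow> real) \<Rightarrow> (nat \<Rightarrow> real) \<Rightarrow> real" where
  "iter_deriv d [] f = f"
| "iter_deriv d (\<theta> # \<theta>s) f = dir_deriv d \<theta> (iter_deriv d \<theta>s f)"

fun iter_diff :: "nat \<Rightarrow> (nat \<Rightarrow> real) list \<Rightarrow> ((nat \<Rightarrow> real) \<Rightarrow> real) \<Rightarrow> bool" where
  "iter_diff d [] f \<longleftrightarrow> True"
| "iter_diff d (\<theta> # \<theta>s) f \<longleftrightarrow> iter_diff d \<theta>s f \<and> dir_diff d \<theta> (iter_deriv d \<theta>s f)"

text \<open>Existence of the derivatives is demanded separately because \<open>Lim\<close> is total.\<close>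

definition C_class :: "nat \<Rightarrow> nat \<Rightarrow> ((nat \<Rightarrow> real) \<Rightarrow> real) set" where
  "C_class d r = {f. \<forall>\<theta>s. length \<theta>s \<le> r \<and> set \<theta>s \<subseteq> unit_sphere d \<longrightarrow>
      iter_diff d \<theta>s f \<and>
      continuous_map (powertop_real {..<d}) euclideanreal (iter_deriv d \<theta>s f)}"

definition F_class :: "nat \<Rightarrow> nat \<Rightarrow> real \<Rightarrow> ((nat \<Rightarrow> real) \<Rightarrow> real) set" where
  "F_class d r \<delta> = {f \<in> C_class d r.
      sup_norm d f \<le> 1 \<and>
      Lip d f \<le> ereal (1 / (\<delta> * sqrt (real d))) \<and>
      (\<forall>k\<in>{1..r}. \<forall>\<theta>s. length \<theta>s = k \<and> set \<theta>s \<subseteq> unit_sphere d \<longrightarrow>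
         Lip d (iter_deriv d \<theta>s f) \<le> ereal (1 / (\<delta> * sqrt (real d)) * (real r / \<delta>) ^ k))}"

text \<open>
  An adaptive algorithm is given by a map \<open>\<psi>\<close> choosing the next sample point from the list of the
  values observed so far, and a map \<open>\<phi>\<close> computing the output from all \<open>n\<close> observed values.
\<close>

fun info :: "(real list \<Rightarrow> nat \<Rightarrow> real) \<Rightarrow> ((nat \<Rightarrow> real) \<Rightarrow> real) \<Rightarrow> nat \<Rightarrow> real list" where
  "info \<psi> f 0 = []"
| "info \<psi> f (Suc n) = info \<psi> f n @ [f (\<psi> (info \<psi> f n))]"

definition algorithms :: "nat \<Rightarrow> nat \<Rightarrow> (((nat \<Rightarrow> real) \<Rightarrow> real) \<Rightarrow> real) set" where
  "algorithms d n = {A. \<exists>\<psi> \<phi>. (\<forall>ys. \<psi> ys \<in> Rd d) \<and> A = (\<lambda>f. \<phi> (info \<psi> f n))}"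

definition integral_on ::
    "(nat \<Rightarrow> (nat \<Rightarrow> real) set) \<Rightarrow> nat \<Rightarrow> ((nat \<Rightarrow> real) \<Rightarrow> real) \<Rightarrow> real" where
  "integral_on D d f = (LINT x:D d|leb d. f x)"

definition worst_case_error ::
    "(nat \<Rightarrow> (nat \<Rightarrow> real) set) \<Rightarrow> nat \<Rightarrow> ((nat \<Rightarrow> real) \<Rightarrow> real) set
      \<Rightarrow> (((nat \<Rightarrow> real) \<Rightarrow> real) \<Rightarrow> real) \<Rightarrow> ereal" where
  "worst_case_error D d F A = (SUP f\<in>F. ereal \<bar>integral_on D d f - A f\<bar>)"

text \<open>The infimum of the empty set is \<open>\<infinity>\<close>, and a nonempty set of \<open>enat\<close> attains its infimum.\<close>

definition complexity ::
    "(nat \<Rightarrow> (nat \<Rightarrow> real) set) \<Rightarrow> nat \<Rightarrow> real \<Rightarrow> ((nat \<Rightarrow> real) \<Rightarrow> real) set \<Rightarrow> enat" where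
  "complexity D d \<epsilon> F =
     Inf (enat ` {n. n \<ge> 1 \<and> (\<exists>A\<in>algorithms d n. worst_case_error D d F A \<le> ereal \<epsilon>)})"

definition curse_of_dimensionality ::
    "(nat \<Rightarrow> (nat \<Rightarrow> real) set) \<Rightarrow> (nat \<Rightarrow> ((nat \<Rightarrow> real) \<Rightarrow> real) set) \<Rightarrow> bool" where
  "curse_of_dimensionality D F \<longleftrightarrow>
     (\<exists>c \<epsilon>\<^sub>0 \<gamma>. c > 0 \<and> \<epsilon>\<^sub>0 > 0 \<and> \<gamma> > 0 \<and>
        infinite {d. d \<ge> 1 \<and>
          (\<forall>\<epsilon>\<in>{0<..\<epsilon>\<^sub>0}. ereal_of_enat (complexity D d \<epsilon> (F d)) \<ge> ereal (c * (1 + \<gamma>) ^ d))})"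

end

theory Submission
  imports Defs
begin

text \<open>
  Fix an algorithm and feed it zeros; let \<open>P\<close> be the resulting set of at most \<open>n\<close> sample points. A
  function \<open>f\<close> in the class with values in \<open>[0, 1]\<close> that vanishes on \<open>P\<close> is indistinguishable from
  \<open>- f\<close>, so the error is at least the integral of \<open>f\<close>. To make this integral large, take
  \<open>R = (1 + \<eta>) \<delta> \<surd>d\<close> and start from the \<open>1 / R\<close>-Lipschitz function that is \<open>0\<close> within distance
  \<open>R\<close> of \<open>P\<close> and \<open>1\<close> beyond distance \<open>2 R\<close>, and convolve it \<open>r\<close> times with a radial kernel of
  radius \<open>\<rho> = R / r\<close>. The result vanishes on \<open>P\<close> and is \<open>1\<close> beyond distance \<open>3 R\<close>, so its integral
  is at least \<open>1\<close> minus the volume of \<open>n\<close> balls of radius \<open>3 R\<close>.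

  Each convolution absorbs one directional derivative at the cost of the factor
  \<open>\<integral> \<bar>D\<^sup>\<theta> g\<bar>\<close>. If \<open>g\<close> is radially decreasing and constant on the ball of radius
  \<open>s = \<rho> / (1 + \<eta>)\<close>, this factor is at most \<open>\<surd>d / s = r / \<delta>\<close>: writing \<open>\<nabla> g (z) = - w (z) z\<close>,
  the integral of the derivative of \<open>z \<mapsto> \<langle>z, \<theta>\<rangle> g (z)\<close> along \<open>\<theta>\<close> vanishes, so
  \<open>\<integral> w (z) \<langle>z, \<theta>\<rangle>\<^sup>2 = \<integral> g = 1\<close>; summing over a basis, \<open>\<integral> w \<le> d / s\<^sup>2\<close>. Finally let \<open>\<eta>\<close> tend to \<open>0\<close>.
\<close>

section \<open>Extensional vectors and Lebesgue measure\<close>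

abbreviation lebM :: "nat \<Rightarrow> (nat \<Rightarrow> real) measure" where
  "lebM d \<equiv> Pi\<^sub>M {..<d} (\<lambda>_. lborel)"

definition inner_on :: "nat \<Rightarrow> (nat \<Rightarrow> real) \<Rightarrow> (nat \<Rightarrow> real) \<Rightarrow> real" where
  "inner_on d x y = (\<Sum>i<d. x i * y i)"

definition lipschitz :: "nat \<Rightarrow> real \<Rightarrow> ((nat \<Rightarrow> real) \<Rightarrow> real) \<Rightarrow> bool" where
  "lipschitz d L f \<longleftrightarrow> (\<forall>x\<in>Rd d. \<forall>y\<in>Rd d. \<bar>f x - f y\<bar> \<le> L * vdist d x y)"

lemma space_lebM: "space (lebM d) = Rd d"
  by (simp add: space_PiM Rd_def)

lemma shift_in_Rd [simp]: "shift d x h \<theta> \<in> Rd d"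
  by (simp add: shift_def Rd_def)

lemma shift_nth: "i < d \<Longrightarrow> shift d x h \<theta> i = x i + h * \<theta> i"
  by (simp add: shift_def)

lemma vnorm_nonneg [simp]: "0 \<le> vnorm d x"
  by (simp add: vnorm_def)

lemma vdist_nonneg [simp]: "0 \<le> vdist d x y"
  by (simp add: vdist_def)

lemma vnorm_power2: "(vnorm d x)\<^sup>2 = inner_on d x x"
  by (simp add: vnorm_def L2_set_def inner_on_def sum_nonneg power2_eq_square)

lemma inner_on_le: "\<bar>inner_on d x y\<bar> \<le> vnorm d x * vnorm d y"
proof -
  have "\<bar>inner_on d x y\<bar> \<le> (\<Sum>i<d. \<bar>x i\<bar> * \<bar>y i\<bar>)"
    unfolding inner_on_def abs_mult[symmetric] by (rule sum_abs)
  then show ?thesis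
    using L2_set_mult_ineq[of x y "{..<d}"] by (simp add: vnorm_def)
qed

lemma vdist_commute: "vdist d x y = vdist d y x"
  by (simp add: vdist_def L2_set_def power2_commute)

lemma vdist_triangle: "vdist d x z \<le> vdist d x y + vdist d y z"
  using L2_set_triangle_ineq[of "\<lambda>i. x i - y i" "\<lambda>i. y i - z i" "{..<d}"]
  by (simp add: vdist_def)

lemma vdist_shift_shift: "vdist d (shift d x h z) (shift d y h z) = vdist d x y"
  unfolding vdist_def by (rule L2_set_cong) (auto simp: shift_nth)

lemma vdist_shift_self: "vdist d (shift d x h z) x = \<bar>h\<bar> * vnorm d z"
proof -
  have "vdist d (shift d x h z) x = L2_set (\<lambda>i. h * z i) {..<d}"
    unfolding vdist_def by (rule L2_set_cong) (auto simp: shift_nth)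
  then show ?thesis
    by (simp add: vnorm_def L2_set_def power_mult_distrib sum_distrib_left[symmetric] real_sqrt_mult)
qed

lemma vdist_le_sum: "vdist d x y \<le> (\<Sum>i<d. \<bar>x i - y i\<bar>)"
  unfolding vdist_def by (rule L2_set_le_sum_abs)

lemma vdist_pos:
  assumes "x \<in> Rd d" "y \<in> Rd d" "x \<noteq> y"
  shows "0 < vdist d x y"
proof -
  have "vdist d x y \<noteq> 0"
    using assms PiE_ext[of x "{..<d}" "\<lambda>_. UNIV" y]
    by (auto simp: vdist_def L2_set_eq_0_iff Rd_def)
  then show ?thesis
    using vdist_nonneg[of d x y] by linarith
qed

lemma vnorm_shift_le: "vnorm d (shift d x h \<theta>) \<le> vnorm d x + \<bar>h\<bar> * vnorm d \<theta>"
proof -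
  have "vnorm d (shift d x h \<theta>) = L2_set (\<lambda>i. x i + h * \<theta> i) {..<d}"
    unfolding vnorm_def by (rule L2_set_cong) (auto simp: shift_nth)
  also have "\<dots> \<le> vnorm d x + L2_set (\<lambda>i. h * \<theta> i) {..<d}"
    unfolding vnorm_def by (rule L2_set_triangle_ineq)
  also have "L2_set (\<lambda>i. h * \<theta> i) {..<d} = \<bar>h\<bar> * vnorm d \<theta>"
    by (simp add: vnorm_def L2_set_def power_mult_distrib sum_distrib_left[symmetric] real_sqrt_mult)
  finally show ?thesis .
qed

lemma inner_on_shift: "inner_on d \<theta> (shift d z h v) = inner_on d \<theta> z + h * inner_on d \<theta> v"
  by (simp add: inner_on_def shift_nth algebra_simps sum.distrib sum_distrib_left)

lemma vnorm_shift_power2: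
  "(vnorm d (shift d z h v))\<^sup>2 = (vnorm d z)\<^sup>2 + 2 * h * inner_on d v z + h\<^sup>2 * (vnorm d v)\<^sup>2"
  unfolding vnorm_power2 inner_on_def
  by (simp add: shift_nth algebra_simps sum.distrib sum_distrib_left power2_eq_square)

lemma shift_shift: "shift d (shift d x h \<theta>) k \<theta> = shift d x (h + k) \<theta>"
  by (auto simp: shift_def algebra_simps)

lemma shift_0: "x \<in> Rd d \<Longrightarrow> shift d x 0 \<theta> = x"
  by (auto simp: shift_def Rd_def PiE_def extensional_def)

lemma shift_add_swap: "shift d (shift d x h \<theta>) 1 z = shift d (shift d x 1 z) h \<theta>"
  by (auto simp: shift_def)

lemma shift_add_swap': "shift d (shift d x h \<theta>) 1 z = shift d x 1 (shift d z h \<theta>)"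
  by (auto simp: shift_def)

lemma measurable_shift [measurable]: "(\<lambda>z. shift d z h \<theta>) \<in> lebM d \<rightarrow>\<^sub>M lebM d"
  unfolding shift_def by measurable

lemma measurable_shift2 [measurable]: "(\<lambda>z. shift d x h z) \<in> lebM d \<rightarrow>\<^sub>M lebM d"
  unfolding shift_def by measurable

lemma measurable_vnorm [measurable]: "vnorm d \<in> borel_measurable (lebM d)"
proof -
  have "(\<lambda>z. sqrt (\<Sum>i<d. (z i)\<^sup>2)) \<in> borel_measurable (lebM d)"
    by measurable
  then show ?thesis by (simp add: vnorm_def[abs_def] L2_set_def)
qed

lemma measurable_inner_on [measurable]: "inner_on d \<theta> \<in> borel_measurable (lebM d)"
proof -
  have "(\<lambda>z. (\<Sum>i<d. \<theta> i * z i)) \<in> borel_measurable (lebM d)"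
    by measurable
  then show ?thesis by (simp add: inner_on_def[abs_def])
qed

lemma measurable_vdist [measurable]: "(\<lambda>x. vdist d x p) \<in> borel_measurable (lebM d)"
proof -
  have "(\<lambda>x. sqrt (\<Sum>i<d. (x i - p i)\<^sup>2)) \<in> borel_measurable (lebM d)"
    by measurable
  then show ?thesis by (simp add: vdist_def[abs_def] L2_set_def)
qed

lemma sets_vball [measurable]: "{z \<in> Rd d. vnorm d z \<le> Q} \<in> sets (lebM d)"
  using measurable_sets[OF measurable_vnorm, of "{..Q}" d]
  by (simp add: vimage_def Int_def conj_commute space_lebM)

lemma distr_shift: "distr (lebM d) (lebM d) (\<lambda>z. shift d z h \<theta>) = lebM d"
proof -
  interpret product_sigma_finite "\<lambda>_::nat. lborel :: real measure" by standard
  show ?thesis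
  proof (rule PiM_eqI)
    fix A :: "nat \<Rightarrow> real set"
    assume A: "\<And>i. i \<in> {..<d} \<Longrightarrow> A i \<in> sets lborel"
    define B where "B i = (\<lambda>t. h * \<theta> i + t) -` A i" for i
    have B: "B i \<in> sets lborel" if "i < d" for i
    proof -
      have "(\<lambda>t. h * \<theta> i + t) \<in> borel \<rightarrow>\<^sub>M borel"
        by measurable
      from measurable_sets[OF this, of "A i"] show ?thesis
        using A[of i] that by (simp add: B_def)
    qed
    have Beq: "emeasure lborel (B i) = emeasure lborel (A i)" if "i < d" for i
    proof -
      have "emeasure lborel (A i) = emeasure (distr lborel borel ((+) (h * \<theta> i))) (A i)"
        by (simp add: lborel_distr_plus)
      also have "\<dots> = emeasure lborel (B i)"
        using A[of i] that by (subst emeasure_distr) (auto simp: B_def)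
      finally show ?thesis by simp
    qed
    have "(\<lambda>z. shift d z h \<theta>) -` Pi\<^sub>E {..<d} A \<inter> space (lebM d) = Pi\<^sub>E {..<d} B"
    proof (rule set_eqI)
      fix z
      show "z \<in> (\<lambda>z. shift d z h \<theta>) -` Pi\<^sub>E {..<d} A \<inter> space (lebM d) \<longleftrightarrow> z \<in> Pi\<^sub>E {..<d} B"
        by (simp add: space_PiM shift_def B_def PiE_iff add.commute[of "z _"] conj_commute)
    qed
    then have "emeasure (distr (lebM d) (lebM d) (\<lambda>z. shift d z h \<theta>)) (Pi\<^sub>E {..<d} A)
        = emeasure (lebM d) (Pi\<^sub>E {..<d} B)"
      using A by (subst emeasure_distr) (auto intro!: sets_PiM_I_finite)
    also have "\<dots> = (\<Prod>i<d. emeasure lborel (B i))"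
      using B by (subst emeasure_PiM) auto
    also have "\<dots> = (\<Prod>i<d. emeasure lborel (A i))"
      by (rule prod.cong) (auto simp: Beq)
    finally show "emeasure (distr (lebM d) (lebM d) (\<lambda>z. shift d z h \<theta>)) (Pi\<^sub>E {..<d} A)
        = (\<Prod>i<d. emeasure lborel (A i))" .
  qed auto
qed

lemma integral_shift:
  fixes F :: "(nat \<Rightarrow> real) \<Rightarrow> real"
  assumes [measurable]: "F \<in> borel_measurable (lebM d)"
  shows "(\<integral>z. F (shift d z h \<theta>) \<partial>lebM d) = (\<integral>z. F z \<partial>lebM d)"
proof -
  have "(\<integral>z. F z \<partial>distr (lebM d) (lebM d) (\<lambda>z. shift d z h \<theta>)) = (\<integral>z. F (shift d z h \<theta>) \<partial>lebM d)"
    using measurable_shift[of d h \<theta>] assms by (rule integral_distr)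
  then show ?thesis by (simp add: distr_shift)
qed

lemma lipschitzD:
  "lipschitz d L f \<Longrightarrow> x \<in> Rd d \<Longrightarrow> y \<in> Rd d \<Longrightarrow> \<bar>f x - f y\<bar> \<le> L * vdist d x y"
  by (simp add: lipschitz_def)

lemma lipschitz_nonneg:
  assumes "lipschitz d L f" "1 \<le> d"
  shows "0 \<le> L"
proof -
  let ?x = "\<lambda>i\<in>{..<d}. 0::real" and ?y = "\<lambda>i\<in>{..<d}. 1::real"
  have mem: "?x \<in> Rd d" "?y \<in> Rd d"
    by (simp_all add: Rd_def)
  have "?x 0 \<noteq> ?y 0"
    using assms(2) by simp
  then have "?x \<noteq> ?y" by (rule contrapos_nn) (rule fun_cong)
  with mem have "0 < vdist d ?x ?y" by (rule vdist_pos)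
  moreover have "0 \<le> L * vdist d ?x ?y"
    using lipschitzD[OF assms(1) mem] by linarith
  ultimately show ?thesis by (simp add: zero_le_mult_iff)
qed

lemma lipschitz_continuous_map:
  assumes f: "lipschitz d L f" and d: "1 \<le> d"
  shows "continuous_map (powertop_real {..<d}) euclideanreal f"
  unfolding continuous_map_atin limitin_canonical_iff
proof
  fix x assume "x \<in> topspace (powertop_real {..<d})"
  then have x: "x \<in> Rd d" by (simp add: Rd_def)
  let ?F = "atin (powertop_real {..<d}) x"
  have proj: "((\<lambda>y. y i) \<longlongrightarrow> x i) ?F" if "i < d" for i
  proof -
    have "continuous_map (powertop_real {..<d}) euclideanreal (\<lambda>y. y i)"
      using that by (intro continuous_map_product_projection) auto
    then have "\<forall>x\<in>topspace (powertop_real {..<d}). limitin euclideanreal (\<lambda>y. y i) (x i) (atin (powertop_real {..<d}) x)"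
      by (simp only: continuous_map_atin)
    then show ?thesis
      using x by (simp add: Rd_def)
  qed
  have "((\<lambda>y. L * (\<Sum>i<d. \<bar>y i - x i\<bar>)) \<longlongrightarrow> L * (\<Sum>i<d. \<bar>x i - x i\<bar>)) ?F"
    by (intro tendsto_intros proj) auto
  then have lim: "((\<lambda>y. L * (\<Sum>i<d. \<bar>y i - x i\<bar>)) \<longlongrightarrow> 0) ?F" by simp
  have "\<forall>\<^sub>F y in ?F. y \<in> topspace (powertop_real {..<d})"
    unfolding eventually_atin using openin_topspace[of "powertop_real {..<d}"] by blast
  then have "\<forall>\<^sub>F y in ?F. norm (f y - f x) \<le> L * (\<Sum>i<d. \<bar>y i - x i\<bar>)"
  proof eventually_elim
    case (elim y)
    then have "\<bar>f y - f x\<bar> \<le> L * vdist d y x"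
      using lipschitzD[OF f _ x, of y] by (auto simp: Rd_def)
    also have "\<dots> \<le> L * (\<Sum>i<d. \<bar>y i - x i\<bar>)"
      by (intro mult_left_mono vdist_le_sum lipschitz_nonneg[OF f d])
    finally show ?case by simp
  qed
  then have "((\<lambda>y. f y - f x) \<longlongrightarrow> 0) ?F"
    using lim by (rule Lim_null_comparison)
  then show "(f \<longlongrightarrow> f x) ?F" by (simp add: LIM_zero_iff)
qed

lemma lipschitz_measurable:
  assumes f: "lipschitz d L f" and d: "1 \<le> d"
  shows "f \<in> borel_measurable (lebM d)"
proof -
  define F where "F y = f (restrict y {..<d})" for y
  have rest: "restrict y {..<d} \<in> Rd d" for y by (simp add: Rd_def)
  have "continuous_on UNIV F"
    unfolding continuous_on_def
  proof
    fix x :: "nat \<Rightarrow> real"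
    have proj: "((\<lambda>y. y i) \<longlongrightarrow> x i) (at x within UNIV)" for i
      using continuous_on_product_coordinates[of i, where 'b = real]
      by (auto simp: continuous_on_def)
    have "((\<lambda>y. L * (\<Sum>i<d. \<bar>y i - x i\<bar>)) \<longlongrightarrow> L * (\<Sum>i<d. \<bar>x i - x i\<bar>)) (at x within UNIV)"
      by (intro tendsto_intros proj)
    then have lim: "((\<lambda>y. L * (\<Sum>i<d. \<bar>y i - x i\<bar>)) \<longlongrightarrow> 0) (at x within UNIV)" by simp
    have "norm (F y - F x) \<le> L * (\<Sum>i<d. \<bar>y i - x i\<bar>)" for y
    proof -
      have "\<bar>F y - F x\<bar> \<le> L * vdist d (restrict y {..<d}) (restrict x {..<d})"
        unfolding F_def by (rule lipschitzD[OF f rest rest])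
      also have "\<dots> \<le> L * (\<Sum>i<d. \<bar>restrict y {..<d} i - restrict x {..<d} i\<bar>)"
        by (intro mult_left_mono vdist_le_sum lipschitz_nonneg[OF f d])
      finally show ?thesis by simp
    qed
    then have "((\<lambda>y. F y - F x) \<longlongrightarrow> 0) (at x within UNIV)"
      by (intro Lim_null_comparison[OF _ lim]) auto
    then show "(F \<longlongrightarrow> F x) (at x within UNIV)" by (simp add: LIM_zero_iff)
  qed
  then have F: "F \<in> borel_measurable (Pi\<^sub>M UNIV (\<lambda>_. borel))"
    using borel_measurable_continuous_onI measurable_cong_sets[OF sets_PiM_equal_borel refl] by blast
  have "(\<lambda>x. \<lambda>i\<in>UNIV. if i < d then x i else 0) \<in> lebM d \<rightarrow>\<^sub>M Pi\<^sub>M UNIV (\<lambda>_. borel)"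
  proof (rule measurable_restrict)
    show "(\<lambda>x. if i < d then x i else 0) \<in> borel_measurable (lebM d)" for i
      by (cases "i < d") auto
  qed
  from measurable_compose[OF this F]
  have "(\<lambda>x. F (\<lambda>i\<in>UNIV. if i < d then x i else 0)) \<in> borel_measurable (lebM d)" .
  then show ?thesis
  proof (subst (asm) measurable_cong)
    fix x assume "x \<in> space (lebM d)"
    then have "restrict (\<lambda>i\<in>UNIV. if i < d then x i else 0) {..<d} = x"
      by (auto simp: space_PiM PiE_def extensional_def fun_eq_iff)
    then show "F (\<lambda>i\<in>UNIV. if i < d then x i else 0) = f x"
      by (simp add: F_def)
  qed
qed

lemma emeasure_vball:
  assumes "0 < Q"
  shows "emeasure (lebM d) {z \<in> Rd d. vnorm d z \<le> Q} = ennreal (unit_ball_vol (real d) * Q ^ d)"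
  using emeasure_cball_aux[of "{..<d}" Q] assms
  by (simp add: vnorm_def L2_set_def Int_def conj_commute space_PiM Rd_def)

lemma emeasure_vball_center:
  assumes "0 < Q"
  shows "emeasure (lebM d) {z \<in> Rd d. vdist d z p \<le> Q} = ennreal (unit_ball_vol (real d) * Q ^ d)"
proof -
  have "{z \<in> Rd d. vdist d z p \<le> Q} = (\<lambda>z. shift d z (-1) p) -` {z \<in> Rd d. vnorm d z \<le> Q} \<inter> space (lebM d)"
  proof -
    have "vnorm d (shift d z (-1) p) = vdist d z p" for z
      unfolding vnorm_def vdist_def by (rule L2_set_cong) (auto simp: shift_nth)
    then show ?thesis by (auto simp: space_lebM)
  qed
  then have "emeasure (lebM d) {z \<in> Rd d. vdist d z p \<le> Q} =
      emeasure (distr (lebM d) (lebM d) (\<lambda>z. shift d z (-1) p)) {z \<in> Rd d. vnorm d z \<le> Q}"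
    by (simp add: emeasure_distr)
  then show ?thesis by (simp add: distr_shift emeasure_vball assms)
qed

lemma integrable_bounded_support:
  fixes F :: "(nat \<Rightarrow> real) \<Rightarrow> real"
  assumes F [measurable]: "F \<in> borel_measurable (lebM d)"
    and bnd: "\<And>z. z \<in> Rd d \<Longrightarrow> vnorm d z \<le> Q \<Longrightarrow> \<bar>F z\<bar> \<le> C"
    and zero: "\<And>z. z \<in> Rd d \<Longrightarrow> Q < vnorm d z \<Longrightarrow> F z = 0"
    and Q: "0 < Q"
  shows "integrable (lebM d) F"
proof (rule integrableI_bounded_set[where A = "{z \<in> space (lebM d). vnorm d z \<le> Q}" and B = C])
  show "emeasure (lebM d) {z \<in> space (lebM d). vnorm d z \<le> Q} < \<infinity>"
    by (simp add: space_lebM emeasure_vball[OF Q])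
qed (use bnd zero sets_vball in \<open>auto simp: space_lebM not_le\<close>)

section \<open>Mollification and directional derivatives\<close>

definition conv :: "nat \<Rightarrow> ((nat \<Rightarrow> real) \<Rightarrow> real) \<Rightarrow> ((nat \<Rightarrow> real) \<Rightarrow> real) \<Rightarrow> (nat \<Rightarrow> real) \<Rightarrow> real" where
  "conv d k f x = (\<integral>z. k z * f (shift d x 1 z) \<partial>lebM d)"

lemma unit_sphereD: "\<theta> \<in> unit_sphere d \<Longrightarrow> vnorm d \<theta> = 1"
  by (simp add: unit_sphere_def)

lemma integrable_shift:
  fixes F :: "(nat \<Rightarrow> real) \<Rightarrow> real"
  assumes "integrable (lebM d) F"
  shows "integrable (lebM d) (\<lambda>z. F (shift d z h \<theta>))"
proof -
  have "integrable (distr (lebM d) (lebM d) (\<lambda>z. shift d z h \<theta>)) F"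
    using assms by (simp only: distr_shift)
  with measurable_shift[of d h \<theta>] show ?thesis by (rule integrable_distr)
qed

lemma directional_mvt:
  assumes deriv: "\<And>z. z \<in> Rd d \<Longrightarrow> ((\<lambda>h. \<phi> (shift d z h \<theta>)) has_real_derivative \<psi> z) (at 0)"
    and bnd: "\<And>z. z \<in> Rd d \<Longrightarrow> \<bar>\<psi> z\<bar> \<le> C"
    and z: "z \<in> Rd d"
  shows "\<bar>\<phi> (shift d z h \<theta>) - \<phi> z\<bar> \<le> C * \<bar>h\<bar>"
proof -
  have "((\<lambda>h. \<phi> (shift d z h \<theta>)) has_real_derivative \<psi> (shift d z k \<theta>)) (at k)" for k
    using deriv[of "shift d z k \<theta>"] DERIV_shift[of "\<lambda>h. \<phi> (shift d z h \<theta>)" _ 0 k]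
    by (simp add: shift_shift add.commute)
  then have "norm (\<phi> (shift d z h \<theta>) - \<phi> (shift d z 0 \<theta>)) \<le> C * norm (h - 0)"
    by (intro field_differentiable_bound[where S = UNIV]) (auto intro!: bnd)
  then show ?thesis using z by (simp add: shift_0)
qed

lemma tendsto_integral_diff_quot:
  fixes \<phi> \<psi> f :: "(nat \<Rightarrow> real) \<Rightarrow> real"
  assumes [measurable]: "\<phi> \<in> borel_measurable (lebM d)" "\<psi> \<in> borel_measurable (lebM d)"
      "f \<in> borel_measurable (lebM d)"
    and deriv: "\<And>z. z \<in> Rd d \<Longrightarrow> ((\<lambda>h. \<phi> (shift d z h \<theta>)) has_real_derivative \<psi> z) (at 0)"
    and bnd: "\<And>z. z \<in> Rd d \<Longrightarrow> \<bar>\<psi> z\<bar> \<le> C"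
    and supp: "\<And>z. z \<in> Rd d \<Longrightarrow> Q < vnorm d z \<Longrightarrow> \<phi> z = 0"
    and f: "\<And>z. z \<in> Rd d \<Longrightarrow> vnorm d z \<le> Q + 1 \<Longrightarrow> \<bar>f z\<bar> \<le> B"
    and Q: "0 < Q" and \<theta>: "vnorm d \<theta> = 1"
  shows "((\<lambda>h. \<integral>z. f z * ((\<phi> (shift d z h \<theta>) - \<phi> z) / h) \<partial>lebM d)
            \<longlongrightarrow> (\<integral>z. f z * \<psi> z \<partial>lebM d)) (at 0)"
proof -
  let ?S = "\<lambda>h z. f z * ((\<phi> (shift d z h \<theta>) - \<phi> z) / h)"
  let ?w = "\<lambda>z. if vnorm d z \<le> Q + 1 then B * C else 0"
  have w: "integrable (lebM d) ?w"
    by (rule integrable_bounded_support[where Q = "Q + 1" and C = "\<bar>B * C\<bar>"]) (use Q in auto)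
  have dom: "\<bar>?S h z\<bar> \<le> ?w z" if z: "z \<in> Rd d" and h: "h \<noteq> 0" "\<bar>h\<bar> \<le> 1" for h z
  proof (cases "vnorm d z \<le> Q + 1")
    case True
    have "\<bar>(\<phi> (shift d z h \<theta>) - \<phi> z) / h\<bar> \<le> C"
      using directional_mvt[of d \<phi> \<theta> \<psi> C z h] deriv bnd z h
      by (simp add: abs_divide divide_simps)
    then have "\<bar>f z\<bar> * \<bar>(\<phi> (shift d z h \<theta>) - \<phi> z) / h\<bar> \<le> B * C"
      using f[OF z True] by (intro mult_mono) auto
    then show ?thesis using True by (simp add: abs_mult)
  next
    case False
    have "vnorm d z \<le> vnorm d (shift d z h \<theta>) + \<bar>h\<bar>"
      using vnorm_shift_le[of d "shift d z h \<theta>" "-h" \<theta>] z \<theta> by (simp add: shift_shift shift_0)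
    then have "\<phi> (shift d z h \<theta>) = 0" "\<phi> z = 0"
      using False h by (auto intro!: supp z)
    then show ?thesis using False by simp
  qed
  show ?thesis
    unfolding tendsto_at_iff_sequentially comp_def
  proof (intro allI impI)
    fix X :: "nat \<Rightarrow> real"
    assume X: "\<forall>i. X i \<in> UNIV - {0}" "X \<longlonglongrightarrow> 0"
    then obtain N where N: "\<And>n. n \<ge> N \<Longrightarrow> \<bar>X n\<bar> < 1"
      using LIMSEQ_D[OF X(2), of 1] by auto
    have "(\<lambda>n. integral\<^sup>L (lebM d) (?S (X (n + N)))) \<longlonglongrightarrow> (\<integral>z. f z * \<psi> z \<partial>lebM d)"
    proof (rule integral_dominated_convergence[where w = ?w])
      show "AE z in lebM d. (\<lambda>n. ?S (X (n + N)) z) \<longlonglongrightarrow> f z * \<psi> z"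
      proof (rule AE_I2)
        fix z assume "z \<in> space (lebM d)"
        then have z: "z \<in> Rd d" by (simp add: space_lebM)
        have "((\<lambda>h. (\<phi> (shift d z h \<theta>) - \<phi> z) / h) \<longlongrightarrow> \<psi> z) (at 0)"
          using deriv[OF z] z by (simp add: DERIV_def shift_0)
        moreover have "filterlim (\<lambda>n. X (n + N)) (at 0) sequentially"
          using X LIMSEQ_ignore_initial_segment[OF X(2), of N] by (auto simp: filterlim_at)
        ultimately have "(\<lambda>n. (\<phi> (shift d z (X (n + N)) \<theta>) - \<phi> z) / X (n + N)) \<longlonglongrightarrow> \<psi> z"
          by (rule filterlim_compose)
        then show "(\<lambda>n. ?S (X (n + N)) z) \<longlonglongrightarrow> f z * \<psi> z"
          by (intro tendsto_mult tendsto_const)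
      qed
      show "AE z in lebM d. norm (?S (X (n + N)) z) \<le> ?w z" for n
      proof (rule AE_I2)
        fix z assume "z \<in> space (lebM d)"
        then show "norm (?S (X (n + N)) z) \<le> ?w z"
          using dom[of z "X (n + N)"] X(1) N[of "n + N"] by (simp add: space_lebM less_imp_le)
      qed
    qed (use w in measurable)
    then show "(\<lambda>n. integral\<^sup>L (lebM d) (?S (X n))) \<longlonglongrightarrow> (\<integral>z. f z * \<psi> z \<partial>lebM d)"
      by (rule LIMSEQ_offset)
  qed
qed

lemma integral_directional_deriv_eq_0:
  fixes \<phi> \<psi> :: "(nat \<Rightarrow> real) \<Rightarrow> real"
  assumes int: "integrable (lebM d) \<phi>" and [measurable]: "\<psi> \<in> borel_measurable (lebM d)"
    and deriv: "\<And>z. z \<in> Rd d \<Longrightarrow> ((\<lambda>h. \<phi> (shift d z h \<theta>)) has_real_derivative \<psi> z) (at 0)"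
    and bnd: "\<And>z. z \<in> Rd d \<Longrightarrow> \<bar>\<psi> z\<bar> \<le> C"
    and supp: "\<And>z. z \<in> Rd d \<Longrightarrow> Q < vnorm d z \<Longrightarrow> \<phi> z = 0"
    and Q: "0 < Q" and \<theta>: "vnorm d \<theta> = 1"
  shows "(\<integral>z. \<psi> z \<partial>lebM d) = 0"
proof -
  have [measurable]: "\<phi> \<in> borel_measurable (lebM d)" using int by simp
  have "((\<lambda>h. \<integral>z. 1 * ((\<phi> (shift d z h \<theta>) - \<phi> z) / h) \<partial>lebM d)
            \<longlongrightarrow> (\<integral>z. 1 * \<psi> z \<partial>lebM d)) (at 0)"
    by (rule tendsto_integral_diff_quot[where C = C and Q = Q and B = 1]) (use assms in auto)
  moreover have "(\<integral>z. 1 * ((\<phi> (shift d z h \<theta>) - \<phi> z) / h) \<partial>lebM d) = 0" for h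
    using integrable_shift[OF int, of h \<theta>] int integral_shift[of \<phi> d h \<theta>] by simp
  ultimately have "((\<lambda>h::real. 0) \<longlongrightarrow> (\<integral>z. \<psi> z \<partial>lebM d)) (at 0)"
    by (simp only: mult_1)
  then show ?thesis using tendsto_unique[OF _ tendsto_const, of "at (0::real)"] by fastforce
qed

locale mollifier =
  fixes d :: nat and s \<rho> C :: real and g w :: "(nat \<Rightarrow> real) \<Rightarrow> real"
  assumes d: "1 \<le> d" and s: "0 < s" and s_less: "s < \<rho>"
    and g_meas [measurable]: "g \<in> borel_measurable (lebM d)"
    and w_meas [measurable]: "w \<in> borel_measurable (lebM d)"
    and g_bnd: "z \<in> Rd d \<Longrightarrow> 0 \<le> g z \<and> g z \<le> C"
    and w_bnd: "z \<in> Rd d \<Longrightarrow> 0 \<le> w z \<and> w z \<le> C"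
    and supp: "z \<in> Rd d \<Longrightarrow> \<rho> < vnorm d z \<Longrightarrow> g z = 0 \<and> w z = 0"
    and w_inner: "z \<in> Rd d \<Longrightarrow> vnorm d z < s \<Longrightarrow> w z = 0"
    and int_g: "(\<integral>z. g z \<partial>lebM d) = 1"
    and deriv_g: "z \<in> Rd d \<Longrightarrow> vnorm d \<theta> = 1 \<Longrightarrow>
      ((\<lambda>h. g (shift d z h \<theta>)) has_real_derivative - w z * inner_on d \<theta> z) (at 0)"
begin

lemma rho_pos: "0 < \<rho>"
  using s s_less by simp

lemma C_nonneg: "0 \<le> C"
  using g_bnd[of "shift d undefined 0 undefined"] by force

lemma integrable_kernel_mult:
  assumes k [measurable]: "k \<in> borel_measurable (lebM d)"
    and kb: "\<And>z. z \<in> Rd d \<Longrightarrow> \<bar>k z\<bar> \<le> C'"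
    and ks: "\<And>z. z \<in> Rd d \<Longrightarrow> \<rho> < vnorm d z \<Longrightarrow> k z = 0"
    and f: "lipschitz d L f" and x: "x \<in> Rd d"
  shows "integrable (lebM d) (\<lambda>z. k z * f (shift d x 1 z))"
proof (rule integrable_bounded_support[where Q = \<rho> and C = "C' * (\<bar>f x\<bar> + L * \<rho>)"])
  have [measurable]: "f \<in> borel_measurable (lebM d)"
    using f d by (rule lipschitz_measurable)
  show "(\<lambda>z. k z * f (shift d x 1 z)) \<in> borel_measurable (lebM d)" by measurable
  fix z assume z: "z \<in> Rd d" "vnorm d z \<le> \<rho>"
  have "\<bar>f (shift d x 1 z) - f x\<bar> \<le> L * vnorm d z"
    using lipschitzD[OF f _ x, of "shift d x 1 z"] by (simp add: vdist_shift_self)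
  also have "\<dots> \<le> L * \<rho>"
    using z lipschitz_nonneg[OF f d] by (intro mult_left_mono) auto
  finally show "\<bar>k z * f (shift d x 1 z)\<bar> \<le> C' * (\<bar>f x\<bar> + L * \<rho>)"
    using kb[OF z(1)] by (auto simp: abs_mult intro!: mult_mono)
qed (use ks rho_pos in auto)

lemma integrable_kernel:
  fixes k :: "(nat \<Rightarrow> real) \<Rightarrow> real"
  assumes k [measurable]: "k \<in> borel_measurable (lebM d)"
    and kb: "\<And>z. z \<in> Rd d \<Longrightarrow> \<bar>k z\<bar> \<le> C'"
    and ks: "\<And>z. z \<in> Rd d \<Longrightarrow> \<rho> < vnorm d z \<Longrightarrow> k z = 0"
  shows "integrable (lebM d) k"
  by (rule integrable_bounded_support[where Q = \<rho> and C = C']) (use assms rho_pos in auto)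

lemma integrable_g: "integrable (lebM d) g"
  by (rule integrable_kernel[where C' = C]) (use g_bnd supp in auto)

lemma integrable_w: "integrable (lebM d) w"
  by (rule integrable_kernel[where C' = C]) (use w_bnd supp in auto)

lemma w_inner_bnd:
  assumes z: "z \<in> Rd d" and \<theta>: "vnorm d \<theta> = 1"
  shows "\<bar>w z * inner_on d \<theta> z\<bar> \<le> C * \<rho>" "\<bar>w z * (inner_on d \<theta> z)\<^sup>2\<bar> \<le> C * \<rho>\<^sup>2"
proof -
  have "\<bar>inner_on d \<theta> z\<bar> \<le> \<rho>" if "vnorm d z \<le> \<rho>"
    using inner_on_le[of d \<theta> z] \<theta> that by simp
  moreover from this have "(inner_on d \<theta> z)\<^sup>2 \<le> \<rho>\<^sup>2" if "vnorm d z \<le> \<rho>"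
    using that rho_pos by (auto simp: abs_le_square_iff[symmetric])
  ultimately show "\<bar>w z * inner_on d \<theta> z\<bar> \<le> C * \<rho>" "\<bar>w z * (inner_on d \<theta> z)\<^sup>2\<bar> \<le> C * \<rho>\<^sup>2"
    using w_bnd[OF z] supp[OF z] C_nonneg rho_pos
    by (cases "vnorm d z \<le> \<rho>"; auto simp: abs_mult intro!: mult_mono)+
qed

lemma integral_w_inner_power2:
  assumes \<theta>: "vnorm d \<theta> = 1"
  shows "integrable (lebM d) (\<lambda>z. w z * (inner_on d \<theta> z)\<^sup>2)"
    and "(\<integral>z. w z * (inner_on d \<theta> z)\<^sup>2 \<partial>lebM d) = 1"
proof -
  show I: "integrable (lebM d) (\<lambda>z. w z * (inner_on d \<theta> z)\<^sup>2)"
    by (rule integrable_kernel[where C' = "C * \<rho>\<^sup>2"]) (use w_inner_bnd(2)[OF _ \<theta>] supp in auto)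
  have \<theta>2: "inner_on d \<theta> \<theta> = 1"
    using \<theta> vnorm_power2[of d \<theta>] by simp
  have "(\<integral>z. g z - w z * (inner_on d \<theta> z)\<^sup>2 \<partial>lebM d) = 0"
  proof (rule integral_directional_deriv_eq_0[where \<phi> = "\<lambda>z. inner_on d \<theta> z * g z"
        and \<theta> = \<theta> and C = "C + C * \<rho>\<^sup>2" and Q = \<rho>])
    show "integrable (lebM d) (\<lambda>z. inner_on d \<theta> z * g z)"
    proof (rule integrable_kernel[where C' = "\<rho> * C"])
      fix z assume z: "z \<in> Rd d"
      show "\<bar>inner_on d \<theta> z * g z\<bar> \<le> \<rho> * C"
        using inner_on_le[of d \<theta> z] \<theta> g_bnd[OF z] supp[OF z] C_nonneg rho_pos
        by (cases "vnorm d z \<le> \<rho>") (auto simp: abs_mult intro!: mult_mono)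
    qed (use supp in auto)
    fix z assume z: "z \<in> Rd d"
    have "((\<lambda>h. (inner_on d \<theta> z + h) * g (shift d z h \<theta>)) has_real_derivative
        (inner_on d \<theta> z + 0) * (- w z * inner_on d \<theta> z) + 1 * g (shift d z 0 \<theta>)) (at 0)"
      by (rule derivative_eq_intros deriv_g[OF z \<theta>] refl | simp)+
    then show "((\<lambda>h. inner_on d \<theta> (shift d z h \<theta>) * g (shift d z h \<theta>)) has_real_derivative
        g z - w z * (inner_on d \<theta> z)\<^sup>2) (at 0)"
      using z by (simp add: inner_on_shift \<theta>2 shift_0 power2_eq_square algebra_simps)
    show "\<bar>g z - w z * (inner_on d \<theta> z)\<^sup>2\<bar> \<le> C + C * \<rho>\<^sup>2"
      using g_bnd[OF z] w_inner_bnd(2)[OF z \<theta>] by linarith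
  qed (use supp \<theta> rho_pos in auto)
  then show "(\<integral>z. w z * (inner_on d \<theta> z)\<^sup>2 \<partial>lebM d) = 1"
    using I integrable_g int_g by simp
qed

lemma integral_w_le: "(\<integral>z. w z \<partial>lebM d) \<le> real d / s\<^sup>2"
proof -
  define e :: "nat \<Rightarrow> nat \<Rightarrow> real" where "e i = (\<lambda>j. if j = i then 1 else 0)" for i
  have e_in: "inner_on d (e i) z = z i" if "i < d" for i z
    using that by (simp add: inner_on_def e_def if_distrib[of "\<lambda>x. x * _"] cong: if_cong)
  have e1: "vnorm d (e i) = 1" if "i < d" for i
    using that by (simp add: vnorm_def L2_set_def e_def if_distrib[of "\<lambda>x. x ^ 2"] cong: if_cong)
  have I: "integrable (lebM d) (\<lambda>z. w z * (inner_on d (e i) z)\<^sup>2)" if "i < d" for i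
    by (rule integral_w_inner_power2(1)[OF e1[OF that]])
  have J: "integrable (lebM d) (\<lambda>z. \<Sum>i<d. w z * (inner_on d (e i) z)\<^sup>2)"
    by (rule Bochner_Integration.integrable_sum) (use I in auto)
  have "(\<integral>z. w z \<partial>lebM d) \<le> (\<integral>z. (\<Sum>i<d. w z * (inner_on d (e i) z)\<^sup>2) / s\<^sup>2 \<partial>lebM d)"
  proof (rule integral_mono)
    fix z assume "z \<in> space (lebM d)"
    then have z: "z \<in> Rd d" by (simp add: space_lebM)
    have "(\<Sum>i<d. w z * (inner_on d (e i) z)\<^sup>2) = w z * (vnorm d z)\<^sup>2"
      unfolding vnorm_power2 inner_on_def[of d z z] sum_distrib_left
      by (rule sum.cong) (auto simp: e_in power2_eq_square)
    moreover have "w z * s\<^sup>2 \<le> w z * (vnorm d z)\<^sup>2"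
      using w_bnd[OF z] w_inner[OF z] s
      by (cases "vnorm d z < s") (auto intro!: mult_left_mono power_mono)
    ultimately show "w z \<le> (\<Sum>i<d. w z * (inner_on d (e i) z)\<^sup>2) / s\<^sup>2"
      using s by (simp add: field_simps)
  qed (use integrable_w J in auto)
  also have "\<dots> = real d / s\<^sup>2"
    using I integral_w_inner_power2(2)[OF e1] by simp
  finally show ?thesis .
qed

text \<open>
  AM-GM with the weight \<open>\<surd>d / s\<close> stands in for the Cauchy-Schwarz inequality, so that only the
  second moment of the gradient is needed and no rotation invariance.
\<close>

lemma integral_abs_gradient_le:
  assumes \<theta>: "vnorm d \<theta> = 1"
  shows "(\<integral>z. \<bar>w z * inner_on d \<theta> z\<bar> \<partial>lebM d) \<le> sqrt (real d) / s"
proof -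
  define \<mu> where "\<mu> = sqrt (real d) / s"
  have \<mu>: "0 < \<mu>" using d s by (simp add: \<mu>_def)
  have amgm: "\<bar>t\<bar> \<le> (\<mu> * t\<^sup>2 + 1 / \<mu>) / 2" for t
  proof -
    have "0 \<le> (\<mu> * \<bar>t\<bar> - 1)\<^sup>2" by simp
    then have "2 * \<mu> * \<bar>t\<bar> \<le> \<mu>\<^sup>2 * t\<^sup>2 + 1"
      by (simp add: power2_diff power_mult_distrib)
    then show ?thesis using \<mu> by (simp add: field_simps power2_eq_square)
  qed
  have "(\<integral>z. \<bar>w z * inner_on d \<theta> z\<bar> \<partial>lebM d)
      \<le> (\<integral>z. (\<mu> * (w z * (inner_on d \<theta> z)\<^sup>2) + w z / \<mu>) / 2 \<partial>lebM d)"
  proof (rule integral_mono)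
    show "integrable (lebM d) (\<lambda>z. \<bar>w z * inner_on d \<theta> z\<bar>)"
      by (rule integrable_kernel[where C' = "C * \<rho>"]) (use w_inner_bnd(1)[OF _ \<theta>] supp in auto)
    fix z assume "z \<in> space (lebM d)"
    then have "0 \<le> w z" using w_bnd by (simp add: space_lebM)
    then show "\<bar>w z * inner_on d \<theta> z\<bar> \<le> (\<mu> * (w z * (inner_on d \<theta> z)\<^sup>2) + w z / \<mu>) / 2"
      using mult_left_mono[OF amgm[of "inner_on d \<theta> z"], of "w z"]
      by (simp add: abs_mult algebra_simps)
  qed (use integral_w_inner_power2[OF \<theta>] integrable_w in auto)
  also have "\<dots> = (\<mu> + (\<integral>z. w z \<partial>lebM d) / \<mu>) / 2"
    using integral_w_inner_power2[OF \<theta>] integrable_w by simp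
  also have "\<dots> \<le> (\<mu> + (real d / s\<^sup>2) / \<mu>) / 2"
    using integral_w_le \<mu> by (intro divide_right_mono add_left_mono) auto
  also have "(real d / s\<^sup>2) / \<mu> = \<mu>"
    using d s by (simp add: \<mu>_def field_simps power2_eq_square)
  finally show ?thesis by (simp add: \<mu>_def)
qed

lemma conv_lipschitz:
  assumes k [measurable]: "k \<in> borel_measurable (lebM d)"
    and kb: "\<And>z. z \<in> Rd d \<Longrightarrow> \<bar>k z\<bar> \<le> C'"
    and ks: "\<And>z. z \<in> Rd d \<Longrightarrow> \<rho> < vnorm d z \<Longrightarrow> k z = 0"
    and f: "lipschitz d L f"
    and K: "(\<integral>z. \<bar>k z\<bar> \<partial>lebM d) \<le> K"
  shows "lipschitz d (K * L) (conv d k f)"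
  unfolding lipschitz_def
proof (intro ballI)
  fix x y assume x: "x \<in> Rd d" and y: "y \<in> Rd d"
  have int: "integrable (lebM d) (\<lambda>z. k z * f (shift d y 1 z))" if "y \<in> Rd d" for y
    using that by (intro integrable_kernel_mult[where C' = C' and L = L]) (use kb ks f in auto)
  have "integrable (lebM d) k"
    by (rule integrable_kernel[where C' = C']) (use kb ks in auto)
  have "\<bar>conv d k f x - conv d k f y\<bar>
      = \<bar>\<integral>z. k z * f (shift d x 1 z) - k z * f (shift d y 1 z) \<partial>lebM d\<bar>"
    using int[OF x] int[OF y] by (simp add: conv_def)
  also have "\<dots> \<le> (\<integral>z. \<bar>k z\<bar> * (L * vdist d x y) \<partial>lebM d)"
  proof (rule integral_abs_bound[THEN order_trans], rule integral_mono)
    show "integrable (lebM d) (\<lambda>z. \<bar>k z * f (shift d x 1 z) - k z * f (shift d y 1 z)\<bar>)"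
      using int[OF x] int[OF y] by (intro integrable_abs Bochner_Integration.integrable_diff)
    show "integrable (lebM d) (\<lambda>z. \<bar>k z\<bar> * (L * vdist d x y))"
      using \<open>integrable (lebM d) k\<close> by (intro integrable_mult_left integrable_abs)
    fix z
    have "\<bar>k z * f (shift d x 1 z) - k z * f (shift d y 1 z)\<bar>
        = \<bar>k z\<bar> * \<bar>f (shift d x 1 z) - f (shift d y 1 z)\<bar>"
      by (simp add: abs_mult[symmetric] right_diff_distrib)
    also have "\<dots> \<le> \<bar>k z\<bar> * (L * vdist d x y)"
      using lipschitzD[OF f, of "shift d x 1 z" "shift d y 1 z"]
      by (intro mult_left_mono) (auto simp: vdist_shift_shift)
    finally show "\<bar>k z * f (shift d x 1 z) - k z * f (shift d y 1 z)\<bar> \<le> \<bar>k z\<bar> * (L * vdist d x y)" .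
  qed
  also have "\<dots> = (\<integral>z. \<bar>k z\<bar> \<partial>lebM d) * (L * vdist d x y)" by simp
  also have "\<dots> \<le> K * (L * vdist d x y)"
    using K lipschitz_nonneg[OF f d] by (intro mult_right_mono) auto
  finally show "\<bar>conv d k f x - conv d k f y\<bar> \<le> K * L * vdist d x y" by simp
qed

lemma conv_g_lipschitz:
  assumes f: "lipschitz d L f"
  shows "lipschitz d L (conv d g f)"
proof -
  have "(\<integral>z. \<bar>g z\<bar> \<partial>lebM d) = (\<integral>z. g z \<partial>lebM d)"
    by (rule Bochner_Integration.integral_cong) (use g_bnd in \<open>auto simp: space_lebM\<close>)
  then have "lipschitz d (1 * L) (conv d g f)"
    using f by (intro conv_lipschitz[where C' = C]) (use g_bnd supp int_g in auto)
  then show ?thesis by simp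
qed

lemma conv_gradient_lipschitz:
  assumes f: "lipschitz d L f" and \<theta>: "vnorm d \<theta> = 1"
  shows "lipschitz d (sqrt (real d) / s * L) (conv d (\<lambda>z. w z * inner_on d \<theta> z) f)"
  by (rule conv_lipschitz[where C' = "C * \<rho>"])
    (use w_inner_bnd(1)[OF _ \<theta>] supp integral_abs_gradient_le[OF \<theta>] f in auto)

lemma conv_diff_quot:
  assumes f: "lipschitz d L f" and \<theta>: "vnorm d \<theta> = 1" and x: "x \<in> Rd d"
  shows "(diff_quot d \<theta> (conv d g f) x \<longlongrightarrow> conv d (\<lambda>z. w z * inner_on d \<theta> z) f x) (at 0)"
proof -
  define \<theta>' where "\<theta>' = (\<lambda>i. - \<theta> i)"
  have sh: "shift d z (- h) \<theta> = shift d z h \<theta>'" for z h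
    by (auto simp: shift_def \<theta>'_def)
  have \<theta>': "vnorm d \<theta>' = 1" and in': "inner_on d \<theta>' z = - inner_on d \<theta> z" for z
    using \<theta> by (simp_all add: vnorm_def L2_set_def \<theta>'_def inner_on_def sum_negf)
  have [measurable]: "f \<in> borel_measurable (lebM d)"
    using f d by (rule lipschitz_measurable)
  let ?f = "\<lambda>z. f (shift d x 1 z)"
  have int: "integrable (lebM d) (\<lambda>z. g z * f (shift d y 1 z))" if "y \<in> Rd d" for y
    using that by (intro integrable_kernel_mult[where C' = C and L = L]) (use g_bnd supp f in auto)
  have eq: "diff_quot d \<theta> (conv d g f) x h = (\<integral>z. ?f z * ((g (shift d z h \<theta>') - g z) / h) \<partial>lebM d)" for h
  proof -
    define H where "H z = g (shift d z h \<theta>') * ?f z" for z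
    have [measurable]: "H \<in> borel_measurable (lebM d)" unfolding H_def by measurable
    have H: "H (shift d z h \<theta>) = g z * f (shift d (shift d x h \<theta>) 1 z)" if "z \<in> Rd d" for z
      using that by (simp add: H_def sh[symmetric] shift_shift shift_0 shift_add_swap')
    have HI: "integrable (lebM d) H"
    proof -
      have "integrable (lebM d) (\<lambda>z. H (shift d z h \<theta>))"
        by (subst Bochner_Integration.integrable_cong[OF refl H]) (auto simp: space_lebM intro!: int)
      from integrable_shift[OF this, of "-h" \<theta>]
      show ?thesis
        by (rule Bochner_Integration.integrable_cong[THEN iffD1, rotated 2])
          (auto simp: shift_shift shift_0 space_lebM)
    qed
    have "conv d g f (shift d x h \<theta>) = (\<integral>z. H (shift d z h \<theta>) \<partial>lebM d)"
      unfolding conv_def by (rule Bochner_Integration.integral_cong) (auto simp: H space_lebM)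
    also have "\<dots> = (\<integral>z. H z \<partial>lebM d)"
      by (rule integral_shift) measurable
    finally have "diff_quot d \<theta> (conv d g f) x h = (1 / h) * ((\<integral>z. H z \<partial>lebM d) - (\<integral>z. g z * ?f z \<partial>lebM d))"
      by (simp add: diff_quot_def conv_def)
    also have "\<dots> = (\<integral>z. (1 / h) * (H z - g z * ?f z) \<partial>lebM d)"
      using HI int[OF x] by simp
    also have "\<dots> = (\<integral>z. ?f z * ((g (shift d z h \<theta>') - g z) / h) \<partial>lebM d)"
      by (rule Bochner_Integration.integral_cong) (auto simp: H_def algebra_simps diff_divide_distrib)
    finally show ?thesis .
  qed
  have "((\<lambda>h. \<integral>z. ?f z * ((g (shift d z h \<theta>') - g z) / h) \<partial>lebM d)
      \<longlongrightarrow> (\<integral>z. ?f z * (- w z * inner_on d \<theta>' z) \<partial>lebM d)) (at 0)"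
  proof (rule tendsto_integral_diff_quot[where C = "C * \<rho>" and Q = \<rho> and B = "\<bar>f x\<bar> + L * (\<rho> + 1)"])
    fix z assume z: "z \<in> Rd d"
    show "\<bar>- w z * inner_on d \<theta>' z\<bar> \<le> C * \<rho>"
      using w_inner_bnd(1)[OF z \<theta>'] by simp
    assume "vnorm d z \<le> \<rho> + 1"
    have "\<bar>f (shift d x 1 z) - f x\<bar> \<le> L * vnorm d z"
      using lipschitzD[OF f _ x, of "shift d x 1 z"] by (simp add: vdist_shift_self)
    also have "\<dots> \<le> L * (\<rho> + 1)"
      using \<open>vnorm d z \<le> \<rho> + 1\<close> lipschitz_nonneg[OF f d] by (intro mult_left_mono) auto
    finally show "\<bar>?f z\<bar> \<le> \<bar>f x\<bar> + L * (\<rho> + 1)" by linarith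
  qed (use supp rho_pos \<theta>' deriv_g in auto)
  then have "((\<lambda>h. diff_quot d \<theta> (conv d g f) x h) \<longlongrightarrow> conv d (\<lambda>z. w z * inner_on d \<theta> z) f x) (at 0)"
    by (simp add: eq in' conv_def mult_ac)
  then show ?thesis .
qed

lemma conv_diff_quot_commute:
  assumes f: "lipschitz d L f" and \<theta>: "vnorm d \<theta> = 1" and x: "x \<in> Rd d"
    and diff: "dir_diff d \<theta> f" and f': "lipschitz d L' (dir_deriv d \<theta> f)"
  shows "(diff_quot d \<theta> (conv d g f) x \<longlongrightarrow> conv d g (dir_deriv d \<theta> f) x) (at 0)"
  unfolding tendsto_at_iff_sequentially comp_def
proof (intro allI impI)
  fix X :: "nat \<Rightarrow> real"
  assume X: "\<forall>i. X i \<in> UNIV - {0}" "X \<longlonglongrightarrow> 0"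
  have [measurable]: "f \<in> borel_measurable (lebM d)" "dir_deriv d \<theta> f \<in> borel_measurable (lebM d)"
    using f f' d by (auto intro: lipschitz_measurable)
  have int: "integrable (lebM d) (\<lambda>z. g z * f (shift d y 1 z))" if "y \<in> Rd d" for y
    using that by (intro integrable_kernel_mult[where C' = C and L = L]) (use g_bnd supp f in auto)
  let ?S = "\<lambda>h z. g z * diff_quot d \<theta> f (shift d x 1 z) h"
  have S_meas [measurable]: "?S h \<in> borel_measurable (lebM d)" for h
    unfolding diff_quot_def by measurable
  have eq: "diff_quot d \<theta> (conv d g f) x h = (\<integral>z. ?S h z \<partial>lebM d)" for h
  proof -
    have "diff_quot d \<theta> (conv d g f) x h
        = (\<integral>z. (1 / h) * (g z * f (shift d (shift d x h \<theta>) 1 z) - g z * f (shift d x 1 z)) \<partial>lebM d)"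
      using int[OF x] int[of "shift d x h \<theta>"] by (simp add: diff_quot_def conv_def)
    also have "\<dots> = (\<integral>z. ?S h z \<partial>lebM d)"
      by (rule Bochner_Integration.integral_cong)
        (auto simp: diff_quot_def shift_add_swap algebra_simps diff_divide_distrib)
    finally show ?thesis .
  qed
  have "(\<lambda>n. integral\<^sup>L (lebM d) (?S (X n))) \<longlonglongrightarrow> (\<integral>z. g z * dir_deriv d \<theta> f (shift d x 1 z) \<partial>lebM d)"
  proof (rule integral_dominated_convergence[where w = "\<lambda>z. L * g z"])
    show "AE z in lebM d. (\<lambda>n. ?S (X n) z) \<longlonglongrightarrow> g z * dir_deriv d \<theta> f (shift d x 1 z)"
    proof (rule AE_I2)
      fix z
      obtain l where l: "(diff_quot d \<theta> f (shift d x 1 z) \<longlongrightarrow> l) (at 0)"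
        using diff by (force simp: dir_diff_def)
      then have "(diff_quot d \<theta> f (shift d x 1 z) \<longlongrightarrow> dir_deriv d \<theta> f (shift d x 1 z)) (at 0)"
        using tendsto_Lim[OF _ l] by (simp add: dir_deriv_def)
      moreover have "filterlim X (at 0) sequentially"
        using X by (auto simp: filterlim_at)
      ultimately have "(\<lambda>n. diff_quot d \<theta> f (shift d x 1 z) (X n)) \<longlonglongrightarrow> dir_deriv d \<theta> f (shift d x 1 z)"
        by (rule filterlim_compose)
      then show "(\<lambda>n. ?S (X n) z) \<longlonglongrightarrow> g z * dir_deriv d \<theta> f (shift d x 1 z)"
        by (intro tendsto_mult tendsto_const)
    qed
    show "AE z in lebM d. norm (?S (X n) z) \<le> L * g z" for n
    proof (rule AE_I2)
      fix z assume "z \<in> space (lebM d)"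
      then have z: "z \<in> Rd d" by (simp add: space_lebM)
      have "\<bar>f (shift d (shift d x 1 z) (X n) \<theta>) - f (shift d x 1 z)\<bar> \<le> L * \<bar>X n\<bar>"
        using lipschitzD[OF f, of "shift d (shift d x 1 z) (X n) \<theta>" "shift d x 1 z"] \<theta>
        by (simp add: vdist_shift_self)
      then have "\<bar>diff_quot d \<theta> f (shift d x 1 z) (X n)\<bar> \<le> L"
        using X(1) by (simp add: diff_quot_def abs_mult divide_simps)
      then show "norm (?S (X n) z) \<le> L * g z"
        using g_bnd[OF z] mult_left_mono[of _ L "g z"] by (simp add: abs_mult mult.commute[of "g z"])
    qed
  qed (use integrable_g in auto)
  then show "(\<lambda>n. diff_quot d \<theta> (conv d g f) x (X n)) \<longlonglongrightarrow> conv d g (dir_deriv d \<theta> f) x"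
    by (simp add: eq conv_def)
qed

end

section \<open>Iterated mollification\<close>

lemma dir_deriv_eqI: "(diff_quot d \<theta> f x \<longlongrightarrow> l) (at 0) \<Longrightarrow> dir_deriv d \<theta> f x = l"
  unfolding dir_deriv_def by (rule tendsto_Lim) auto

lemma diff_quot_cong:
  "(\<And>x. x \<in> Rd d \<Longrightarrow> f x = f' x) \<Longrightarrow> x \<in> Rd d \<Longrightarrow> diff_quot d \<theta> f x = diff_quot d \<theta> f' x"
  by (simp add: diff_quot_def fun_eq_iff)

lemma lipschitz_cong:
  "(\<And>x. x \<in> Rd d \<Longrightarrow> f x = f' x) \<Longrightarrow> lipschitz d L f \<longleftrightarrow> lipschitz d L f'"
  by (simp add: lipschitz_def)

lemma lipschitz_imp_Lip_le:
  assumes "lipschitz d L f" "L \<le> L'"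
  shows "Lip d f \<le> ereal L'"
  unfolding Lip_def
proof (rule SUP_least, clarify)
  fix x y assume xy: "x \<in> Rd d" "y \<in> Rd d" "x \<noteq> y"
  have "\<bar>f x - f y\<bar> / vdist d x y \<le> L"
    using lipschitzD[OF assms(1) xy(1,2)] vdist_pos[OF xy] by (simp add: divide_simps)
  then show "ereal (\<bar>f x - f y\<bar> / vdist d x y) \<le> ereal L'"
    using assms(2) by simp
qed

lemma conv_uminus: "conv d k (\<lambda>x. - f x) = (\<lambda>x. - conv d k f x)"
  by (simp add: conv_def fun_eq_iff)

lemma funpow_conv_uminus: "(conv d k ^^ j) (\<lambda>x. - f x) = (\<lambda>x. - (conv d k ^^ j) f x)"
  by (induction j) (auto simp: conv_uminus)

context mollifier
begin

lemma conv_between: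
  assumes f: "lipschitz d L f" and x: "x \<in> Rd d"
    and ab: "\<And>x. x \<in> Rd d \<Longrightarrow> a \<le> f x \<and> f x \<le> b"
  shows "a \<le> conv d g f x \<and> conv d g f x \<le> b"
proof -
  have int: "integrable (lebM d) (\<lambda>z. g z * f (shift d x 1 z))"
    by (rule integrable_kernel_mult[where C' = C and L = L]) (use g_bnd supp f x in auto)
  have "(\<integral>z. g z * a \<partial>lebM d) \<le> conv d g f x"
    unfolding conv_def
    by (rule integral_mono)
      (use int integrable_g g_bnd ab in \<open>auto intro!: mult_left_mono simp: space_lebM\<close>)
  moreover have "conv d g f x \<le> (\<integral>z. g z * b \<partial>lebM d)"
    unfolding conv_def
    by (rule integral_mono)
      (use int integrable_g g_bnd ab in \<open>auto intro!: mult_left_mono simp: space_lebM\<close>)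
  ultimately show ?thesis using int_g by simp
qed

lemma conv_locally_constant:
  assumes x: "x \<in> Rd d" and c: "\<And>y. y \<in> Rd d \<Longrightarrow> vdist d y x \<le> \<rho> \<Longrightarrow> f y = c"
  shows "conv d g f x = c"
proof -
  have "conv d g f x = (\<integral>z. g z * c \<partial>lebM d)"
    unfolding conv_def
  proof (rule Bochner_Integration.integral_cong[OF refl])
    fix z assume "z \<in> space (lebM d)"
    then show "g z * f (shift d x 1 z) = g z * c"
      using supp[of z] c[of "shift d x 1 z"]
      by (cases "vnorm d z \<le> \<rho>") (auto simp: space_lebM vdist_shift_self)
  qed
  then show ?thesis using int_g by simp
qed

lemma funpow_conv_lipschitz: "lipschitz d L f \<Longrightarrow> lipschitz d L ((conv d g ^^ j) f)"
  by (induction j) (auto intro: conv_g_lipschitz)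

lemma funpow_conv_between:
  assumes f: "lipschitz d L f" and x: "x \<in> Rd d"
    and ab: "\<And>x. x \<in> Rd d \<Longrightarrow> a \<le> f x \<and> f x \<le> b"
  shows "a \<le> (conv d g ^^ j) f x \<and> (conv d g ^^ j) f x \<le> b"
  using x
proof (induction j arbitrary: x)
  case (Suc j)
  then show ?case
    using conv_between[OF funpow_conv_lipschitz[OF f] Suc.prems, of a j b] by simp
qed (use ab in simp)

lemma funpow_conv_locally_constant:
  assumes "x \<in> Rd d" "\<And>y. y \<in> Rd d \<Longrightarrow> vdist d y x \<le> real j * \<rho> \<Longrightarrow> f y = c"
  shows "(conv d g ^^ j) f x = c"
  using assms
proof (induction j arbitrary: x)
  case 0
  then show ?case by (simp add: vdist_def L2_set_def)
next
  case (Suc j)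
  have "(conv d g ^^ j) f y = c" if y: "y \<in> Rd d" "vdist d y x \<le> \<rho>" for y
  proof (rule Suc.IH[OF y(1)])
    fix v assume v: "v \<in> Rd d" "vdist d v y \<le> real j * \<rho>"
    have "vdist d v x \<le> real (Suc j) * \<rho>"
      using vdist_triangle[of d v x y] v y by (simp add: algebra_simps)
    then show "f v = c" by (rule Suc.prems(2)[OF v(1)])
  qed
  then show ?case
    using conv_locally_constant[OF Suc.prems(1)] by simp
qed

lemma iter_deriv_funpow_conv:
  assumes h: "lipschitz d L h"
  shows "length \<theta>s \<le> j \<Longrightarrow> set \<theta>s \<subseteq> unit_sphere d \<Longrightarrow>
      iter_diff d \<theta>s ((conv d g ^^ j) h) \<and>
      lipschitz d ((sqrt (real d) / s) ^ length \<theta>s * L) (iter_deriv d \<theta>s ((conv d g ^^ j) h)) \<and>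
      (\<forall>x\<in>Rd d. iter_deriv d \<theta>s ((conv d g ^^ Suc j) h) x
         = conv d g (iter_deriv d \<theta>s ((conv d g ^^ j) h)) x)"
proof (induction \<theta>s arbitrary: j)
  case Nil
  then show ?case using funpow_conv_lipschitz[OF h] by simp
next
  case (Cons \<theta> \<theta>s)
  then obtain j' where j: "j = Suc j'" "length \<theta>s \<le> j'" by (cases j) auto
  have \<theta>: "vnorm d \<theta> = 1" and \<theta>s: "set \<theta>s \<subseteq> unit_sphere d"
    using Cons.prems by (auto simp: unit_sphereD)
  define m where "m i = iter_deriv d \<theta>s ((conv d g ^^ i) h)" for i
  define M where "M = (sqrt (real d) / s) ^ length \<theta>s * L"
  have m: "lipschitz d M (m i)" "\<And>x. x \<in> Rd d \<Longrightarrow> m (Suc i) x = conv d g (m i) x"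
    and diff: "iter_diff d \<theta>s ((conv d g ^^ i) h)" if "j' \<le> i" for i
    using Cons.IH[of i] \<theta>s j(2) that unfolding m_def M_def by auto
  have lim: "(diff_quot d \<theta> (m j) x \<longlongrightarrow> conv d (\<lambda>z. w z * inner_on d \<theta> z) (m j') x) (at 0)"
    if x: "x \<in> Rd d" for x
  proof -
    have "diff_quot d \<theta> (m j) x = diff_quot d \<theta> (conv d g (m j')) x"
      using m(2)[of j'] x by (intro diff_quot_cong) (auto simp: j)
    then show ?thesis
      using conv_diff_quot[OF m(1) \<theta> x, of j'] by simp
  qed
  then have dd: "dir_diff d \<theta> (m j)" by (auto simp: dir_diff_def)
  have "lipschitz d (sqrt (real d) / s * M) (conv d (\<lambda>z. w z * inner_on d \<theta> z) (m j'))"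
    by (rule conv_gradient_lipschitz[OF m(1) \<theta>]) simp
  then have lip: "lipschitz d (sqrt (real d) / s * M) (dir_deriv d \<theta> (m j))"
    by (subst lipschitz_cong[OF dir_deriv_eqI[OF lim]])
  have "dir_deriv d \<theta> (m (Suc j)) x = conv d g (dir_deriv d \<theta> (m j)) x" if x: "x \<in> Rd d" for x
  proof (rule dir_deriv_eqI)
    have "diff_quot d \<theta> (m (Suc j)) x = diff_quot d \<theta> (conv d g (m j)) x"
      using m(2)[of j] x by (intro diff_quot_cong) (auto simp: j)
    then show "(diff_quot d \<theta> (m (Suc j)) x \<longlongrightarrow> conv d g (dir_deriv d \<theta> (m j)) x) (at 0)"
      using conv_diff_quot_commute[OF m(1) \<theta> x dd lip] by (simp add: j)
  qed
  note commute = this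
  show ?case
  proof (intro conjI ballI)
    show "iter_diff d (\<theta> # \<theta>s) ((conv d g ^^ j) h)"
      using diff[of j] j(1) dd unfolding m_def iter_diff.simps by simp
    show "lipschitz d ((sqrt (real d) / s) ^ length (\<theta> # \<theta>s) * L) (iter_deriv d (\<theta> # \<theta>s) ((conv d g ^^ j) h))"
      using lip unfolding m_def M_def iter_deriv.simps by (simp only: length_Cons power_Suc mult.assoc)
    show "iter_deriv d (\<theta> # \<theta>s) ((conv d g ^^ Suc j) h) x
        = conv d g (iter_deriv d (\<theta> # \<theta>s) ((conv d g ^^ j) h)) x" if "x \<in> Rd d" for x
      using commute[OF that] unfolding m_def iter_deriv.simps .
  qed
qed

lemma funpow_conv_in_F_class:
  assumes h: "lipschitz d L h" and h1: "\<And>x. x \<in> Rd d \<Longrightarrow> \<bar>h x\<bar> \<le> 1"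
    and L: "L \<le> 1 / (\<delta> * sqrt (real d))" and K: "sqrt (real d) / s \<le> real r / \<delta>"
    and \<delta>: "0 < \<delta>"
  shows "(conv d g ^^ r) h \<in> F_class d r \<delta>"
proof -
  let ?f = "(conv d g ^^ r) h"
  note iter = iter_deriv_funpow_conv[OF h]
  have "\<bar>?f x\<bar> \<le> 1" if "x \<in> Rd d" for x
    using funpow_conv_between[OF h that, of "-1" 1 r] h1 by (force simp: abs_le_iff)
  then have "sup_norm d ?f \<le> 1"
    unfolding sup_norm_def by (intro SUP_least) simp
  moreover have "Lip d ?f \<le> ereal (1 / (\<delta> * sqrt (real d)))"
    by (rule lipschitz_imp_Lip_le[OF funpow_conv_lipschitz[OF h] L])
  moreover have "Lip d (iter_deriv d \<theta>s ?f) \<le> ereal (1 / (\<delta> * sqrt (real d)) * (real r / \<delta>) ^ length \<theta>s)"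
    if "length \<theta>s \<le> r" "set \<theta>s \<subseteq> unit_sphere d" for \<theta>s
  proof (rule lipschitz_imp_Lip_le)
    show "lipschitz d ((sqrt (real d) / s) ^ length \<theta>s * L) (iter_deriv d \<theta>s ?f)"
      using iter[of \<theta>s r] that by blast
    have "(sqrt (real d) / s) ^ length \<theta>s * L \<le> (real r / \<delta>) ^ length \<theta>s * (1 / (\<delta> * sqrt (real d)))"
      using K L s \<delta> lipschitz_nonneg[OF h d] by (intro mult_mono power_mono) auto
    then show "(sqrt (real d) / s) ^ length \<theta>s * L \<le> 1 / (\<delta> * sqrt (real d)) * (real r / \<delta>) ^ length \<theta>s"
      by (simp add: mult.commute)
  qed
  moreover have "?f \<in> C_class d r"
    unfolding C_class_def
  proof (intro CollectI allI impI)
    fix \<theta>s :: "(nat \<Rightarrow> real) list"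
    assume "length \<theta>s \<le> r \<and> set \<theta>s \<subseteq> unit_sphere d"
    then have "iter_diff d \<theta>s ?f"
      and "lipschitz d ((sqrt (real d) / s) ^ length \<theta>s * L) (iter_deriv d \<theta>s ?f)"
      using iter[of \<theta>s r] by blast+
    then show "iter_diff d \<theta>s ?f \<and> continuous_map (powertop_real {..<d}) euclideanreal (iter_deriv d \<theta>s ?f)"
      using lipschitz_continuous_map[OF _ d] by blast
  qed
  ultimately show ?thesis
    unfolding F_class_def by auto
qed

end

lemma has_real_derivative_max_0_power2:
  "((\<lambda>t::real. (max 0 t)\<^sup>2) has_real_derivative 2 * max 0 t) (at t)"
proof (cases "t = 0")
  case True
  have "((\<lambda>h::real. (max 0 h)\<^sup>2 / h) \<longlongrightarrow> 0) (at 0)"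
  proof (rule Lim_null_comparison)
    show "\<forall>\<^sub>F h::real in at 0. norm ((max 0 h)\<^sup>2 / h) \<le> \<bar>h\<bar>"
      by (rule always_eventually) (auto simp: max_def power2_eq_square)
    show "((\<lambda>h::real. \<bar>h\<bar>) \<longlongrightarrow> 0) (at 0)"
      by (rule tendsto_rabs_zero) simp
  qed
  then show ?thesis using True by (simp add: DERIV_def)
next
  case False
  then consider "t < 0" | "t > 0" by linarith
  then show ?thesis
  proof cases
    case 1
    have "((\<lambda>t::real. (max 0 t)\<^sup>2) has_real_derivative 0) (at t)"
      by (rule has_field_derivative_transform_within_open[OF DERIV_const[of 0], where S = "{..<0}"])
        (use 1 in auto)
    then show ?thesis using 1 by simp
  next
    case 2
    have "((\<lambda>t::real. t\<^sup>2) has_real_derivative 2 * t) (at t)"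
      by (auto intro!: derivative_eq_intros)
    then have "((\<lambda>t::real. (max 0 t)\<^sup>2) has_real_derivative 2 * t) (at t)"
      by (rule has_field_derivative_transform_within_open[where S = "{0<..}"]) (use 2 in auto)
    then show ?thesis using 2 by simp
  qed
qed

text \<open>
  The second difference of \<open>t \<mapsto> (max 0 t)\<^sup>2\<close> with step \<open>(b - a) / 2\<close> is a continuously
  differentiable step function, decreasing from a plateau on \<open>t \<le> a\<close> to \<open>0\<close> on \<open>t \<ge> b\<close>.
\<close>

lemma smooth_step_exists:
  fixes a b :: real
  assumes ab: "a < b"
  obtains p q :: "real \<Rightarrow> real" and C c where
    "\<And>t. (p has_real_derivative - q t) (at t)"
    "\<And>t. 0 \<le> p t \<and> p t \<le> C" "\<And>t. 0 \<le> q t \<and> q t \<le> C"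
    "\<And>t. t \<le> a \<Longrightarrow> q t = 0" "\<And>t. t \<le> a \<Longrightarrow> p t = c" "\<And>t. b < t \<Longrightarrow> p t = 0 \<and> q t = 0"
    "0 < c" "continuous_on UNIV p" "continuous_on UNIV q"
proof
  define m where "m = (a + b) / 2"
  define k where "k = (b - a) / 2"
  have k: "0 < k" using ab by (simp add: k_def)
  have a: "a = m - k" and b: "b = m + k" by (simp_all add: m_def k_def field_simps)
  define p where "p t = (max 0 (b - t))\<^sup>2 - 2 * (max 0 (m - t))\<^sup>2 + (max 0 (a - t))\<^sup>2" for t
  define q where "q t = 2 * (max 0 (b - t) - 2 * max 0 (m - t) + max 0 (a - t))" for t
  show deriv: "(p has_real_derivative - q t) (at t)" for t
  proof -
    have D: "((\<lambda>t. (max 0 (c - t))\<^sup>2) has_real_derivative - (2 * max 0 (c - t))) (at t)" for c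
    proof -
      have "((\<lambda>t. c - t) has_real_derivative - 1) (at t)"
        by (auto intro!: derivative_eq_intros)
      from DERIV_chain2[where f = "\<lambda>t. (max 0 t)\<^sup>2", OF has_real_derivative_max_0_power2 this]
      show ?thesis by simp
    qed
    show ?thesis
      unfolding p_def[abs_def]
      by (rule DERIV_cong[OF DERIV_add[OF DERIV_diff[OF D[of b] DERIV_cmult[OF D[of m], of 2]] D[of a]]])
        (simp add: q_def)
  qed
  have q0: "0 \<le> q t" "q t \<le> 2 * k" "t \<le> a \<Longrightarrow> q t = 0" "b < t \<Longrightarrow> q t = 0" for t
    using k unfolding q_def a b by (auto simp: max_def)
  have pa: "p t = 2 * k\<^sup>2" if "t \<le> a" for t
  proof -
    have "max 0 (b - t) = b - t" "max 0 (m - t) = m - t" "max 0 (a - t) = a - t"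
      using that k unfolding a b by auto
    then show ?thesis
      unfolding p_def by (simp only:) (simp add: a b power2_eq_square algebra_simps)
  qed
  have pb: "p t = 0" if "b < t" for t
    using that k unfolding p_def a b by (simp add: max_def)
  have mono: "p t \<le> p u" if "u \<le> t" for t u
  proof (rule DERIV_nonpos_imp_nonincreasing[OF that])
    show "\<exists>y. (p has_real_derivative y) (at x) \<and> y \<le> 0" for x
      using deriv[of x] q0(1)[of x] by (intro exI[of _ "- q x"]) simp
  qed
  show "0 \<le> p t \<and> p t \<le> max (2 * k) (2 * k\<^sup>2)" for t
  proof
    show "0 \<le> p t"
      using mono[of t "b + 1"] pb[of "b + 1"] pb[of t] by (cases "t \<le> b") auto
    show "p t \<le> max (2 * k) (2 * k\<^sup>2)"
      using mono[of a t] pa[of a] pa[of t] by (cases "t \<le> a") auto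
  qed
  show "0 \<le> q t \<and> q t \<le> max (2 * k) (2 * k\<^sup>2)" for t
    using q0(1,2)[of t] by linarith
  show "q t = 0" if "t \<le> a" for t by (rule q0(3)[OF that])
  show "p t = 2 * k\<^sup>2" if "t \<le> a" for t by (rule pa[OF that])
  show "p t = 0 \<and> q t = 0" if "b < t" for t using pb[OF that] q0(4)[OF that] by simp
  show "0 < 2 * k\<^sup>2" using k by simp
  show "continuous_on UNIV p" "continuous_on UNIV q"
    unfolding p_def q_def by (intro continuous_intros)+
qed

lemma mollifier_exists:
  assumes d: "1 \<le> d" and s: "0 < s" "s < \<rho>"
  obtains C g w where "mollifier d s \<rho> C g w"
proof -
  have "s\<^sup>2 < \<rho>\<^sup>2" using s by (intro power_strict_mono) auto
  then obtain p q :: "real \<Rightarrow> real" and C c where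
    p': "\<And>t. (p has_real_derivative - q t) (at t)"
    and p: "\<And>t. 0 \<le> p t \<and> p t \<le> C" and q: "\<And>t. 0 \<le> q t \<and> q t \<le> C"
    and qa: "\<And>t. t \<le> s\<^sup>2 \<Longrightarrow> q t = 0" and pa: "\<And>t. t \<le> s\<^sup>2 \<Longrightarrow> p t = c"
    and pqb: "\<And>t. \<rho>\<^sup>2 < t \<Longrightarrow> p t = 0 \<and> q t = 0"
    and c: "0 < c" and cont: "continuous_on UNIV p" "continuous_on UNIV q"
    by (rule smooth_step_exists) (rule that; assumption)
  have [measurable]: "p \<in> borel_measurable borel" "q \<in> borel_measurable borel"
    using cont by (auto intro: borel_measurable_continuous_onI)
  define G where "G z = p ((vnorm d z)\<^sup>2)" for z
  define W where "W z = 2 * q ((vnorm d z)\<^sup>2)" for z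
  define I where "I = (\<integral>z. G z \<partial>lebM d)"
  have [measurable]: "G \<in> borel_measurable (lebM d)" "W \<in> borel_measurable (lebM d)"
    unfolding G_def W_def by measurable
  have G0: "G z = 0 \<and> W z = 0" if "\<rho> < vnorm d z" for z
    using pqb[of "(vnorm d z)\<^sup>2"] that s by (simp add: G_def W_def power_strict_mono)
  have intG: "integrable (lebM d) G"
    by (rule integrable_bounded_support[where Q = \<rho> and C = C]) (use p G0 s in \<open>auto simp: G_def\<close>)
  have I: "0 < I"
  proof -
    let ?B = "{z \<in> Rd d. vnorm d z \<le> s}"
    have "0 < c * measure (lebM d) ?B"
      using c s by (simp add: measure_def emeasure_vball)
    also have "\<dots> = (\<integral>z. c * indicator ?B z \<partial>lebM d)"
      using emeasure_vball[OF s(1), of d] by simp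
    also have "\<dots> \<le> I"
      unfolding I_def
    proof (rule integral_mono[OF _ intG])
      show "integrable (lebM d) (\<lambda>z. c * indicator ?B z :: real)"
        using emeasure_vball[OF s(1), of d] by (intro integrable_mult_right integrable_real_indicator) auto
      show "c * indicator ?B z \<le> G z" for z
        using pa[of "(vnorm d z)\<^sup>2"] p by (auto simp: G_def indicator_def power_mono)
    qed
    finally show ?thesis .
  qed
  have "mollifier d s \<rho> (2 * C / I) (\<lambda>z. G z / I) (\<lambda>z. W z / I)"
  proof
    fix z \<theta> assume z: "z \<in> Rd d" and \<theta>: "vnorm d \<theta> = 1"
    have "((\<lambda>h. (vnorm d z)\<^sup>2 + 2 * h * inner_on d \<theta> z + h\<^sup>2) has_real_derivative
        2 * inner_on d \<theta> z) (at 0)"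
      by (rule derivative_eq_intros refl | simp)+
    from DERIV_chain2[where f = p, OF p' this]
    have "((\<lambda>h. G (shift d z h \<theta>)) has_real_derivative - W z * inner_on d \<theta> z) (at 0)"
      by (simp add: G_def W_def vnorm_shift_power2 \<theta> mult_ac)
    from DERIV_cdivide[OF this, of I]
    show "((\<lambda>h. G (shift d z h \<theta>) / I) has_real_derivative - (W z / I) * inner_on d \<theta> z) (at 0)"
      by simp
  next
    fix z
    have "0 \<le> G z \<and> G z \<le> 2 * C" "0 \<le> W z \<and> W z \<le> 2 * C"
      using p[of "(vnorm d z)\<^sup>2"] q[of "(vnorm d z)\<^sup>2"] by (auto simp: G_def W_def)
    then show "0 \<le> G z / I \<and> G z / I \<le> 2 * C / I" "0 \<le> W z / I \<and> W z / I \<le> 2 * C / I"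
      using I by (auto simp: divide_right_mono)
    show "W z / I = 0" if "vnorm d z < s"
      using qa[of "(vnorm d z)\<^sup>2"] that by (simp add: W_def power_mono)
    show "G z / I = 0 \<and> W z / I = 0" if "\<rho> < vnorm d z"
      using G0[OF that] by simp
  next
    show "(\<integral>z. G z / I \<partial>lebM d) = 1"
      using I by (simp add: I_def)
  qed (use d s in auto)
  then show thesis by (rule that)
qed

section \<open>Volume of balls\<close>

lemma Gamma_ge_powr:
  fixes x :: real
  assumes x: "0 < x"
  shows "(x / exp 1) powr x \<le> Gamma (x + 1)"
proof -
  have "ennreal ((x / exp 1) powr x) = (\<integral>\<^sup>+t. ennreal (x powr x * exp (- t)) * indicator {x..} t \<partial>lborel)"
  proof -
    have "(\<integral>\<^sup>+t. ennreal (x powr x * exp (- t)) * indicator {x..} t \<partial>lborel)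
        = ennreal (0 - (- (x powr x * exp (- x))))"
    proof (rule nn_integral_FTC_atLeast[where F = "\<lambda>t. - (x powr x * exp (- t))"])
      have "((\<lambda>t::real. - (x powr x * exp (- t))) \<longlongrightarrow> - (x powr x * 0)) at_top"
        by (intro tendsto_intros filterlim_compose[OF exp_at_bot] filterlim_uminus_at_bot_at_top)
      then show "((\<lambda>t::real. - (x powr x * exp (- t))) \<longlongrightarrow> 0) at_top" by simp
    qed (auto intro!: derivative_eq_intros)
    moreover have "(x / exp 1) powr x = x powr x * exp (- x)"
      using x by (simp add: powr_divide powr_def[of "exp 1"] exp_minus_inverse exp_minus field_simps)
    ultimately show ?thesis by simp
  qed
  also have "\<dots> \<le> (\<integral>\<^sup>+t. ennreal (indicator {0..} t * t powr ((x + 1) - 1) / exp t) \<partial>lborel)"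
  proof (rule nn_integral_mono)
    fix t :: real
    show "ennreal (x powr x * exp (- t)) * indicator {x..} t
        \<le> ennreal (indicator {0..} t * t powr ((x + 1) - 1) / exp t)"
      using x by (auto simp: indicator_def exp_minus divide_inverse intro!: ennreal_leI mult_right_mono powr_mono2)
  qed
  also have "\<dots> = ennreal (Gamma (x + 1))"
    using x by (intro Gamma_conv_nn_integral_real[symmetric]) simp
  finally show ?thesis
    using x by (simp add: ennreal_le_iff Gamma_real_pos less_imp_le)
qed

lemma unit_ball_vol_le:
  assumes d: "1 \<le> d"
  shows "unit_ball_vol (real d) * sqrt (real d) ^ d \<le> sqrt (2 * pi * exp 1) ^ d"
proof -
  define x where "x = real d / 2"
  have x: "0 < x" using d by (simp add: x_def)
  have pw: "sqrt y ^ d = y powr x" if "0 < y" for y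
    using that by (simp add: powr_half_sqrt[symmetric] powr_realpow[symmetric] powr_powr x_def)
  have "unit_ball_vol (real d) \<le> pi powr x / (x / exp 1) powr x"
    unfolding unit_ball_vol_def x_def[symmetric]
    using Gamma_ge_powr[OF x] x by (intro divide_left_mono mult_pos_pos Gamma_real_pos) auto
  also have "\<dots> = (pi * exp 1 / x) powr x"
    using x by (simp add: powr_divide powr_mult)
  finally have "unit_ball_vol (real d) * sqrt (real d) ^ d \<le> (pi * exp 1 / x) powr x * real d powr x"
    using pw[of "real d"] d by (simp add: mult_right_mono)
  also have "\<dots> = (2 * pi * exp 1) powr x"
    using x d by (simp add: powr_mult[symmetric] x_def field_simps)
  also have "\<dots> = sqrt (2 * pi * exp 1) ^ d"
    by (rule pw[symmetric]) simp
  finally show ?thesis .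
qed

section \<open>Fooling functions\<close>

definition bump :: "nat \<Rightarrow> (nat \<Rightarrow> real) set \<Rightarrow> real \<Rightarrow> (nat \<Rightarrow> real) \<Rightarrow> real" where
  "bump d P R x = max 0 (min 1 (Min (vdist d x ` P) / R - 1))"

lemma bump_bounds: "0 \<le> bump d P R x \<and> bump d P R x \<le> 1"
  by (simp add: bump_def)

lemma bump_lipschitz:
  assumes P: "finite P" "P \<noteq> {}" and R: "0 < R"
  shows "lipschitz d (1 / R) (bump d P R)"
proof -
  define u where "u x = Min (vdist d x ` P)" for x
  have half: "u x \<le> u y + vdist d x y" for x y
  proof -
    have "u y \<in> vdist d y ` P"
      unfolding u_def using P by (intro Min_in) auto
    then obtain p where p: "p \<in> P" "u y = vdist d y p" by auto
    have "u x \<le> vdist d x p"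
      unfolding u_def using P p(1) by (intro Min_le) auto
    then show ?thesis
      using vdist_triangle[of d x p y] p(2) by simp
  qed
  have "\<bar>u x / R - u y / R\<bar> \<le> 1 / R * vdist d x y" for x y
  proof -
    have "\<bar>u x - u y\<bar> \<le> vdist d x y"
      using half[of x y] half[of y x] by (simp add: vdist_commute[of d y x])
    then have "\<bar>u x - u y\<bar> / R \<le> vdist d x y / R"
      using R by (intro divide_right_mono) auto
    then show ?thesis
      using R by (simp add: diff_divide_distrib[symmetric] abs_divide)
  qed
  moreover have "\<bar>max 0 (min 1 (a - 1)) - max 0 (min 1 (b - 1))\<bar> \<le> \<bar>a - b\<bar>" for a b :: real
    by (simp add: max_def min_def)
  ultimately have "\<bar>max 0 (min 1 (u x / R - 1)) - max 0 (min 1 (u y / R - 1))\<bar> \<le> 1 / R * vdist d x y" for x y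
    by (rule order_trans[rotated])
  then show ?thesis
    unfolding lipschitz_def bump_def u_def by blast
qed

lemma bump_eq_0:
  assumes P: "finite P" "p \<in> P" and "vdist d x p \<le> R" "0 < R"
  shows "bump d P R x = 0"
proof -
  have "Min (vdist d x ` P) \<le> vdist d x p"
    using P by (intro Min_le) auto
  also have "\<dots> \<le> R" by fact
  finally have "Min (vdist d x ` P) / R \<le> 1"
    using \<open>0 < R\<close> by simp
  then show ?thesis by (simp add: bump_def)
qed

lemma bump_eq_1:
  assumes P: "finite P" "P \<noteq> {}" and "\<And>p. p \<in> P \<Longrightarrow> 2 * R \<le> vdist d x p" "0 < R"
  shows "bump d P R x = 1"
proof -
  have "2 * R \<le> Min (vdist d x ` P)"
    using assms by (intro Min.boundedI) auto
  then have "2 \<le> Min (vdist d x ` P) / R"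
    using assms by (simp add: divide_simps)
  then show ?thesis by (simp add: bump_def)
qed

lemma fooling_function_exists:
  assumes d: "1 \<le> d" and r: "1 \<le> r" and \<delta>: "0 < \<delta>" and \<eta>: "0 < \<eta>"
    and P: "finite P" "P \<noteq> {}" "P \<subseteq> Rd d"
    and R: "R = (1 + \<eta>) * (\<delta> * sqrt (real d))"
  obtains f L where "f \<in> F_class d r \<delta>" "(\<lambda>x. - f x) \<in> F_class d r \<delta>" "lipschitz d L f"
    "\<And>x. x \<in> Rd d \<Longrightarrow> 0 \<le> f x \<and> f x \<le> 1" "\<And>p. p \<in> P \<Longrightarrow> f p = 0"
    "\<And>x. x \<in> Rd d \<Longrightarrow> \<forall>p\<in>P. 3 * R < vdist d x p \<Longrightarrow> f x = 1"
proof -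
  have R0: "0 < R" using d \<delta> \<eta> by (simp add: R)
  define \<rho> where "\<rho> = R / real r"
  define s where "s = \<rho> / (1 + \<eta>)"
  have \<rho>: "0 < \<rho>" and s: "0 < s" "s < \<rho>" and r\<rho>: "real r * \<rho> = R"
    using R0 r \<eta> by (auto simp: \<rho>_def s_def divide_simps)
  from d s obtain C g w where "mollifier d s \<rho> C g w"
    by (rule mollifier_exists)
  then interpret mollifier d s \<rho> C g w .
  define h where "h = bump d P R"
  have h: "lipschitz d (1 / R) h"
    unfolding h_def by (rule bump_lipschitz[OF P(1,2) R0])
  then have h': "lipschitz d (1 / R) (\<lambda>x. - h x)"
    by (simp add: lipschitz_def abs_minus_commute)
  let ?f = "(conv d g ^^ r) h"
  have L: "1 / R \<le> 1 / (\<delta> * sqrt (real d))"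
    using d \<delta> \<eta> by (simp add: R frac_le)
  have K: "sqrt (real d) / s \<le> real r / \<delta>"
    using d \<delta> \<eta> r by (simp add: s_def \<rho>_def R)
  show thesis
  proof
    show "?f \<in> F_class d r \<delta>"
      by (rule funpow_conv_in_F_class[OF h _ L K \<delta>]) (use bump_bounds in \<open>simp add: h_def\<close>)
    have "(conv d g ^^ r) (\<lambda>x. - h x) \<in> F_class d r \<delta>"
      by (rule funpow_conv_in_F_class[OF h' _ L K \<delta>]) (use bump_bounds in \<open>simp add: h_def\<close>)
    then show "(\<lambda>x. - ?f x) \<in> F_class d r \<delta>" by (simp only: funpow_conv_uminus)
    show "lipschitz d (1 / R) ?f" by (rule funpow_conv_lipschitz[OF h])
    show "0 \<le> ?f x \<and> ?f x \<le> 1" if "x \<in> Rd d" for x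
      by (rule funpow_conv_between[OF h that]) (use bump_bounds in \<open>simp add: h_def\<close>)
    show "?f p = 0" if p: "p \<in> P" for p
    proof (rule funpow_conv_locally_constant)
      show "p \<in> Rd d" using p P by auto
      show "h y = 0" if "vdist d y p \<le> real r * \<rho>" for y
        using that p P R0 unfolding h_def r\<rho> by (intro bump_eq_0) auto
    qed
    show "?f x = 1" if x: "x \<in> Rd d" and far: "\<forall>p\<in>P. 3 * R < vdist d x p" for x
    proof (rule funpow_conv_locally_constant[OF x])
      fix y assume y: "vdist d y x \<le> real r * \<rho>"
      have "2 * R \<le> vdist d y p" if "p \<in> P" for p
        using bspec[OF far that] vdist_triangle[of d x p y] y unfolding r\<rho> by (simp add: vdist_commute[of d x y])
      then show "h y = 1"
        unfolding h_def by (intro bump_eq_1 P R0)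
    qed
  qed
qed

lemma integral_on_ge:
  assumes D: "D d \<in> sets (leb d)" "emeasure (leb d) (D d) = 1"
    and d: "1 \<le> d" and f: "lipschitz d L f"
    and f01: "\<And>x. x \<in> Rd d \<Longrightarrow> 0 \<le> f x \<and> f x \<le> 1"
    and P: "finite P" and Q: "0 < Q"
    and f1: "\<And>x. x \<in> Rd d \<Longrightarrow> \<forall>p\<in>P. Q < vdist d x p \<Longrightarrow> f x = 1"
  shows "1 - real (card P) * (unit_ball_vol (real d) * Q ^ d) \<le> integral_on D d f"
proof -
  define B where "B p = {x \<in> Rd d. vdist d x p \<le> Q}" for p
  have space: "space (leb d) = Rd d" by (simp add: leb_def space_lebM)
  have B_sets: "B p \<in> sets (lebM d)" for p
    using measurable_sets[OF measurable_vdist[of d p], of "{..Q}"]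
    by (simp add: B_def vimage_def Int_def conj_commute space_lebM)
  then have B: "B p \<in> sets (leb d)"
    and B_em: "emeasure (leb d) (B p) = ennreal (unit_ball_vol (real d) * Q ^ d)" for p
    by (simp_all add: leb_def B_def emeasure_vball_center[OF Q])
  have [measurable]: "f \<in> borel_measurable (leb d)"
    unfolding leb_def by (rule measurable_completion[OF lipschitz_measurable[OF f d]])
  have iB: "integrable (leb d) (\<lambda>x. indicator (B p) x :: real)" for p
    using B B_em[of p] by (intro integrable_real_indicator) auto
  have iD: "integrable (leb d) (\<lambda>x. indicator (D d) x :: real)"
    using D by (intro integrable_real_indicator) auto
  have mB: "measure (leb d) (B p) = unit_ball_vol (real d) * Q ^ d" for p
    using B_em[of p] Q by (simp add: measure_def)
  have mD: "measure (leb d) (D d) = 1"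
    using D(2) by (simp add: measure_def)
  have iS: "integrable (leb d) (\<lambda>x. \<Sum>p\<in>P. indicator (B p) x :: real)"
    by (rule Bochner_Integration.integrable_sum) (rule iB)
  have "1 - real (card P) * (unit_ball_vol (real d) * Q ^ d)
      = (\<integral>x. indicator (D d) x - (\<Sum>p\<in>P. indicator (B p) x) \<partial>leb d)"
    using iD iB iS D(1) B by (simp add: Bochner_Integration.integral_sum mB mD)
  also have "\<dots> \<le> (\<integral>x. indicator (D d) x *\<^sub>R f x \<partial>leb d)"
  proof (rule integral_mono)
    show "integrable (leb d) (\<lambda>x. indicator (D d) x - (\<Sum>p\<in>P. indicator (B p) x) :: real)"
      using iD iS by (rule Bochner_Integration.integrable_diff)
    show "integrable (leb d) (\<lambda>x. indicator (D d) x *\<^sub>R f x)"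
    proof (rule Bochner_Integration.integrable_bound[OF iD])
      show "(\<lambda>x. indicator (D d) x *\<^sub>R f x) \<in> borel_measurable (leb d)"
        using D(1) by measurable
    qed (use f01 in \<open>auto simp: space indicator_def\<close>)
    fix x assume "x \<in> space (leb d)"
    then have x: "x \<in> Rd d" by (simp add: space)
    have S0: "0 \<le> (\<Sum>p\<in>P. indicator (B p) x :: real)" by (simp add: sum_nonneg)
    show "indicator (D d) x - (\<Sum>p\<in>P. indicator (B p) x) \<le> indicator (D d) x *\<^sub>R f x"
    proof (cases "\<exists>p\<in>P. vdist d x p \<le> Q")
      case True
      then obtain p where p: "p \<in> P" "vdist d x p \<le> Q" by auto
      have "indicator (B p) x \<le> (\<Sum>p\<in>P. indicator (B p) x :: real)"
        using p(1) P by (intro member_le_sum) auto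
      then have "1 \<le> (\<Sum>p\<in>P. indicator (B p) x :: real)"
        using p(2) x by (simp add: B_def)
      then show ?thesis
        using f01[OF x] by (auto simp: indicator_def[of "D d"])
    next
      case False
      then have "f x = 1" by (intro f1 x) auto
      then show ?thesis using S0 by simp
    qed
  qed
  finally show ?thesis
    by (simp add: integral_on_def set_lebesgue_integral_def)
qed

lemma info_eq_replicate:
  assumes "\<And>i. i < n \<Longrightarrow> f (\<psi> (replicate i 0)) = 0"
  shows "info \<psi> f n = replicate n 0"
  using assms by (induction n) (auto simp: replicate_append_same[symmetric])

lemma algorithm_size_ge_aux:
  assumes D: "D d \<in> sets (leb d)" "emeasure (leb d) (D d) = 1"
    and d: "1 \<le> d" and r: "1 \<le> r" and \<delta>: "0 < \<delta>" and n: "1 \<le> n" and \<eta>: "0 < \<eta>"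
    and A: "A \<in> algorithms d n" and err: "worst_case_error D d (F_class d r \<delta>) A \<le> ereal \<epsilon>"
  shows "1 - \<epsilon> \<le> real n * ((1 + \<eta>) * (\<delta> * sqrt (18 * exp 1 * pi))) ^ d"
proof -
  obtain \<psi> \<phi> where \<psi>: "\<And>ys. \<psi> ys \<in> Rd d" and A_eq: "A = (\<lambda>f. \<phi> (info \<psi> f n))"
    using A by (auto simp: algorithms_def)
  define P where "P = (\<lambda>i. \<psi> (replicate i 0)) ` {..<n}"
  define R where "R = (1 + \<eta>) * (\<delta> * sqrt (real d))"
  have R0: "0 < R" using d \<delta> \<eta> by (simp add: R_def)
  have P: "finite P" "P \<noteq> {}" "P \<subseteq> Rd d"
    using n \<psi> by (auto simp: P_def lessThan_empty_iff)
  have cardP: "card P \<le> n"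
    unfolding P_def using card_image_le[of "{..<n}"] by simp
  obtain f L where f: "f \<in> F_class d r \<delta>" "(\<lambda>x. - f x) \<in> F_class d r \<delta>" "lipschitz d L f"
    and f01: "\<And>x. x \<in> Rd d \<Longrightarrow> 0 \<le> f x \<and> f x \<le> 1" and fP: "\<And>p. p \<in> P \<Longrightarrow> f p = 0"
    and f1: "\<And>x. x \<in> Rd d \<Longrightarrow> \<forall>p\<in>P. 3 * R < vdist d x p \<Longrightarrow> f x = 1"
    by (rule fooling_function_exists[OF d r \<delta> \<eta> P R_def]) (rule that)
  have "info \<psi> f n = replicate n 0" "info \<psi> (\<lambda>x. - f x) n = replicate n 0"
    using fP by (auto intro!: info_eq_replicate simp: P_def)
  then have A0: "A f = \<phi> (replicate n 0)" "A (\<lambda>x. - f x) = \<phi> (replicate n 0)"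
    by (simp_all add: A_eq)
  have "\<bar>integral_on D d u - A u\<bar> \<le> \<epsilon>" if "u \<in> F_class d r \<delta>" for u
    using order_trans[OF SUP_upper[OF that] err[unfolded worst_case_error_def]] by simp
  from this[OF f(1)] this[OF f(2)]
  have "integral_on D d f \<le> \<epsilon>"
    by (simp add: A0 integral_on_def set_lebesgue_integral_def)
  moreover have "1 - real (card P) * (unit_ball_vol (real d) * (3 * R) ^ d) \<le> integral_on D d f"
    by (rule integral_on_ge[where L = L]) (use D d f(3) P(1) R0 f01 f1 in auto)
  moreover have "real (card P) * (unit_ball_vol (real d) * (3 * R) ^ d)
      \<le> real n * ((1 + \<eta>) * (\<delta> * sqrt (18 * exp 1 * pi))) ^ d"
  proof (rule mult_mono)
    have "3 * R = 3 * ((1 + \<eta>) * \<delta>) * sqrt (real d)" by (simp add: R_def)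
    then have "unit_ball_vol (real d) * (3 * R) ^ d
        = (3 * ((1 + \<eta>) * \<delta>)) ^ d * (unit_ball_vol (real d) * sqrt (real d) ^ d)"
      by (simp only: power_mult_distrib[of _ "sqrt (real d)"]) (simp only: mult_ac)
    also have "\<dots> \<le> (3 * ((1 + \<eta>) * \<delta>)) ^ d * sqrt (2 * pi * exp 1) ^ d"
      using unit_ball_vol_le[OF d] \<delta> \<eta> by (intro mult_left_mono) auto
    also have "\<dots> = ((1 + \<eta>) * (\<delta> * (3 * sqrt (2 * pi * exp 1)))) ^ d"
      by (simp only: power_mult_distrib[symmetric]) (simp only: mult_ac)
    also have "3 * sqrt (2 * pi * exp 1) = sqrt (18 * exp 1 * pi)"
    proof -
      have "sqrt (18 * exp 1 * pi) = sqrt (3\<^sup>2 * (2 * pi * exp 1))"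
        by (simp add: mult_ac)
      then show ?thesis by (simp only: real_sqrt_mult) simp
    qed
    finally show "unit_ball_vol (real d) * (3 * R) ^ d
        \<le> ((1 + \<eta>) * (\<delta> * sqrt (18 * exp 1 * pi))) ^ d" .
  qed (use cardP R0 in auto)
  ultimately show ?thesis by linarith
qed

lemma algorithm_size_ge:
  assumes D: "D d \<in> sets (leb d)" "emeasure (leb d) (D d) = 1"
    and d: "1 \<le> d" and r: "1 \<le> r" and \<delta>: "0 < \<delta>" and n: "1 \<le> n"
    and A: "A \<in> algorithms d n" and err: "worst_case_error D d (F_class d r \<delta>) A \<le> ereal \<epsilon>"
  shows "1 - \<epsilon> \<le> real n * (\<delta> * sqrt (18 * exp 1 * pi)) ^ d"
proof -
  let ?F = "\<lambda>\<eta>. real n * ((1 + \<eta>) * (\<delta> * sqrt (18 * exp 1 * pi))) ^ d"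
  have "(?F \<longlongrightarrow> ?F 0) (at_right 0)"
    by (intro tendsto_intros)
  moreover have "\<forall>\<^sub>F \<eta> in at_right 0. 1 - \<epsilon> \<le> ?F \<eta>"
    using eventually_at_right_less[of 0]
    by (rule eventually_mono) (rule algorithm_size_ge_aux[OF D d r \<delta> n _ A err])
  ultimately show ?thesis
    using tendsto_lowerbound[of ?F "?F 0" "at_right 0" "1 - \<epsilon>"] by simp
qed

lemma complexity_ge:
  assumes "\<And>n A. 1 \<le> n \<Longrightarrow> A \<in> algorithms d n \<Longrightarrow> worst_case_error D d F A \<le> ereal \<epsilon> \<Longrightarrow> b \<le> real n"
  shows "ereal b \<le> ereal_of_enat (complexity D d \<epsilon> F)"
proof -
  let ?N = "{n. n \<ge> 1 \<and> (\<exists>A\<in>algorithms d n. worst_case_error D d F A \<le> ereal \<epsilon>)}"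
  show ?thesis
  proof (cases "?N = {}")
    case True
    have "complexity D d \<epsilon> F = \<infinity>"
      unfolding complexity_def True by (simp add: top_enat_def)
    then show ?thesis by simp
  next
    case False
    then obtain k where "k \<in> enat ` ?N" by blast
    then have "(LEAST x. x \<in> enat ` ?N) \<in> enat ` ?N" by (rule LeastI)
    then have "Inf (enat ` ?N) \<in> enat ` ?N"
      unfolding Inf_enat_def by (simp only: image_is_empty False if_False)
    then obtain n where "n \<in> ?N" "complexity D d \<epsilon> F = enat n"
      unfolding complexity_def by auto
    then show ?thesis using assms[of n] by auto
  qed
qed

theorem theorem2:
  fixes D :: "nat \<Rightarrow> (nat \<Rightarrow> real) set" and r :: nat and \<delta> :: real
  assumes D_meas: "\<And>d. d \<ge> 1 \<Longrightarrow> D d \<in> sets (leb d)"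
    and D_vol: "\<And>d. d \<ge> 1 \<Longrightarrow> emeasure (leb d) (D d) = 1"
    and r: "r \<ge> 1"
    and \<delta>: "0 < \<delta>" "\<delta> \<le> 1"
  shows "(\<forall>d\<ge>1. \<forall>\<epsilon>. 0 < \<epsilon> \<and> \<epsilon> < 1 \<longrightarrow>
            ereal_of_enat (complexity D d \<epsilon> (F_class d r \<delta>)) \<ge>
              ereal ((1 - \<epsilon>) *
                (if d = 1 then 1 else (\<delta> * sqrt (18 * exp 1 * pi)) powi (- int d)))) \<and>
         (\<delta> < 1 / sqrt (18 * exp 1 * pi) \<longrightarrow>
            curse_of_dimensionality D (\<lambda>d. F_class d r \<delta>))"
proof -
  define q where "q = \<delta> * sqrt (18 * exp 1 * pi)"
  have q: "0 < q" using \<delta> by (simp add: q_def)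
  have bound: "ereal ((1 - \<epsilon>) * (if d = 1 then 1 else q powi (- int d)))
      \<le> ereal_of_enat (complexity D d \<epsilon> (F_class d r \<delta>))"
    if d: "1 \<le> d" and \<epsilon>: "0 < \<epsilon>" for d \<epsilon>
  proof (rule complexity_ge)
    fix n :: nat and A
    assume n: "1 \<le> n" and A: "A \<in> algorithms d n"
      and err: "worst_case_error D d (F_class d r \<delta>) A \<le> ereal \<epsilon>"
    have "1 - \<epsilon> \<le> real n * q ^ d"
      unfolding q_def by (rule algorithm_size_ge[OF D_meas[OF d] D_vol[OF d] d r \<delta>(1) n A err])
    then have "(1 - \<epsilon>) * q powi (- int d) \<le> real n"
      using q by (simp add: power_int_minus field_simps)
    then show "(1 - \<epsilon>) * (if d = 1 then 1 else q powi (- int d)) \<le> real n"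
      using n \<epsilon> by auto
  qed
  have "curse_of_dimensionality D (\<lambda>d. F_class d r \<delta>)" if "\<delta> < 1 / sqrt (18 * exp 1 * pi)"
    unfolding curse_of_dimensionality_def
  proof (rule exI[of _ "1 / 2"], rule exI[of _ "1 / 2"], rule exI[of _ "1 / q - 1"], intro conjI)
    have "q < 1" using that by (simp add: q_def field_simps)
    then show "0 < 1 / q - 1" using q by (simp add: field_simps)
    show "0 < (1 / 2 :: real)" "0 < (1 / 2 :: real)" by simp_all
    show "infinite {d. d \<ge> 1 \<and> (\<forall>\<epsilon>\<in>{0<..1 / 2}. ereal_of_enat (complexity D d \<epsilon> (F_class d r \<delta>))
        \<ge> ereal (1 / 2 * (1 + (1 / q - 1)) ^ d))}"
    proof (rule infinite_super[OF _ infinite_Ici[of "2 :: nat"]], intro subsetI CollectI conjI ballI)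
      fix d :: nat assume "d \<in> {2..}"
      then have d: "2 \<le> d" by simp
      then show "1 \<le> d" by simp
      fix \<epsilon> :: real assume \<epsilon>: "\<epsilon> \<in> {0<..1 / 2}"
      have "1 / 2 * (1 + (1 / q - 1)) ^ d = 1 / 2 * q powi (- int d)"
        using q by (simp add: power_int_minus power_divide field_simps)
      also have "\<dots> \<le> (1 - \<epsilon>) * q powi (- int d)"
        using \<epsilon> q by (intro mult_right_mono) auto
      finally have "ereal (1 / 2 * (1 + (1 / q - 1)) ^ d) \<le> ereal ((1 - \<epsilon>) * q powi (- int d))"
        by simp
      also have "\<dots> \<le> ereal_of_enat (complexity D d \<epsilon> (F_class d r \<delta>))"
        using bound[of d \<epsilon>] d \<epsilon> by auto
      finally show "ereal (1 / 2 * (1 + (1 / q - 1)) ^ d) \<le> ereal_of_enat (complexity D d \<epsilon> (F_class d r \<delta>))" .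
    qed
  qed
  then show ?thesis
    using bound unfolding q_def by blast
qed

end
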